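(* Let $\mathcal X\subset\mathbb R^d$ be nonempty, closed and convex, and let $\ell:\mathcal X\times\Xi\to\mathbb R$ be such that for $P_0$-almost all $\xi\in\Xi$ the function $\ell(\cdot;\xi)$ is proper, closed (lower semicontinuous) and convex on $\mathcal X$. Assume either $\mathcal X$ is compact or $x\mapsto\mathbb E_{P_0}[\ell(x;\xi)]$ is coercive, i.e. $\mathbb E_{P_0}[\ell(x;\xi)]\to\infty$ as $\|x\|\to\infty$. Assume that for some $\epsilon>0$, $\mathbb E_{P_0}[|\ell(x;\xi)|^{1+\epsilon}]<\infty$ for all $x\in\mathcal X$, and that there is a function $g:\mathcal X\times\Xi\to\mathbb R$ such that each $x\in\mathcal X$ has a neighborhood $U$ with $\inf_{z\in U}\ell(z;\xi)\ge g(x,\xi)$ and $\mathbb E_{P_0}[|g(x,\xi)|]<\infty$. Let $f$ satisfy the smoothness assumption in the context and $\rho>0$. Let $\xi_1,\xi_2,\dots$ be i.i.d. with distribution $P_0$, with empirical distributions $\widehat P_n$, and assume $\mathbb E_{\widehat P_n}[|\ell(x;\xi)|^{1+\epsilon}]\to\mathbb E_{P_0}[|\ell(x;\xi)|^{1+\epsilon}]$ almost surely for each $x\in\mathcal X$. Then $$\inf_{x\in\mathcal X}\sup_{P\ll\widehat P_n}\Big\{\mathbb E_P[\ell(x;\xi)]:D_f(P\|\widehat P_n)\le\tfrac\rho n\Big\}\to\inf_{x\in\mathcal X}\mathbb E_{P_0}[\ell(x;\xi)]$$ in outer probability, and $d_{\subset}(S^\star_{\widehat P_n},S^\star_{P_0})\to0$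 in outer probability, where $$S^\star_{P_0}=\operatorname*{argmin}_{x\in\mathcal X}\mathbb E_{P_0}[\ell(x;\xi)],\qquad S^\star_{\widehat P_n}=\operatorname*{argmin}_{x\in\mathcal X}\sup_{P\ll\widehat P_n}\Big\{\mathbb E_P[\ell(x;\xi)]:D_f(P\|\widehat P_n)\le\tfrac\rho n\Big\}.$$
   Context: $(\Xi,\mathcal A,P_0)$ is a probability space with $\Xi$ a subset of a separable metric space; $\ell(x;\cdot)$ is measurable for each $x$. Smoothness assumption on $f$: $f:[0,\infty)\to\mathbb R\cup\{+\infty\}$ is lower semicontinuous and convex, three times differentiable in a neighborhood of $1$, with $f(1)=f'(1)=0$ and $f''(1)=2$. For probability measures $P\ll Q$, $D_f(P\|Q)=\int f\!\left(\frac{dP}{dQ}\right)dQ$. For sets $A,B\subset\mathbb R^d$, $d_{\subset}(A,B)=\sup_{x\in A}\operatorname{dist}(x,B)$, where $\operatorname{dist}(x,B)=\inf_{y\in B}\|x-y\|$. *)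

theory Defs
  imports "HOL-Probability.Probability"
begin

definition lsc_on :: "'a::topological_space set \<Rightarrow> ('a \<Rightarrow> ereal) \<Rightarrow> bool" where
  "lsc_on S h \<longleftrightarrow> (\<forall>x\<in>S. h x \<le> Liminf (at x within S) h)"

definition proper_on :: "'a set \<Rightarrow> ('a \<Rightarrow> ereal) \<Rightarrow> bool" where
  "proper_on S h \<longleftrightarrow> (\<forall>x\<in>S. h x \<noteq> -\<infinity>) \<and> (\<exists>x\<in>S. h x \<noteq> \<infinity>)"

(* For functions that do not take the value -\<infinity>; the product uses 0 * \<infinity> = 0. *)
definition ereal_convex_on :: "'a::real_vector set \<Rightarrow> ('a \<Rightarrow> ereal) \<Rightarrow> bool" where
  "ereal_convex_on S h \<longleftrightarrow> convex S \<and>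
     (\<forall>x\<in>S. \<forall>y\<in>S. \<forall>u\<ge>0. \<forall>v\<ge>0. u + v = 1 \<longrightarrow>
        h (u *\<^sub>R x + v *\<^sub>R y) \<le> ereal u * h x + ereal v * h y)"

(* The domain of f is {0..}; values at negative arguments are irrelevant.
   Three times differentiable on U means that f, f' and f'' are differentiable on U. *)
definition smooth_divergence_function :: "(real \<Rightarrow> ereal) \<Rightarrow> bool" where
  "smooth_divergence_function f \<longleftrightarrow>
     (\<forall>t\<ge>0. f t \<noteq> -\<infinity>) \<and> lsc_on {0..} f \<and> ereal_convex_on {0..} f \<and>
     (\<exists>U. open U \<and> 1 \<in> U \<and> U \<subseteq> {0..} \<and> (\<forall>t\<in>U. f t \<noteq> \<infinity>) \<and>
        (\<forall>t\<in>U. \<forall>k<3. (deriv ^^ k) (\<lambda>s. real_of_ereal (f s)) differentiable (at t))) \<and>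
     f 1 = 0 \<and>
     deriv (\<lambda>s. real_of_ereal (f s)) 1 = 0 \<and>
     (deriv ^^ 2) (\<lambda>s. real_of_ereal (f s)) 1 = 2"

(* The integral of an extended-real function as the integral of its positive part minus
   that of its negative part (e2ennreal maps negative numbers to 0). For convex f and
   probability measures the second integral is finite. *)
definition f_divergence :: "(real \<Rightarrow> ereal) \<Rightarrow> 'a measure \<Rightarrow> 'a measure \<Rightarrow> ereal" where
  "f_divergence f P Q =
     enn2ereal (\<integral>\<^sup>+\<xi>. e2ennreal (f (enn2real (RN_deriv Q P \<xi>))) \<partial>Q)
     - enn2ereal (\<integral>\<^sup>+\<xi>. e2ennreal (- f (enn2real (RN_deriv Q P \<xi>))) \<partial>Q)"

(* Note the argument order: absolutely_continuous Q P is P \<lless> Q. *)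
definition divergence_ball :: "(real \<Rightarrow> ereal) \<Rightarrow> 'a measure \<Rightarrow> real \<Rightarrow> 'a measure set" where
  "divergence_ball f Q r =
     {P. prob_space P \<and> sets P = sets Q \<and> absolutely_continuous Q P \<and>
         f_divergence f P Q \<le> ereal r}"

definition worst_case_risk ::
    "(real \<Rightarrow> ereal) \<Rightarrow> real \<Rightarrow> 'a measure \<Rightarrow> ('a \<Rightarrow> real) \<Rightarrow> ereal" where
  "worst_case_risk f r Q h = (SUP P\<in>divergence_ball f Q r. ereal (\<integral>\<xi>. h \<xi> \<partial>P))"

(* The empirical distribution, on the sigma-algebra of N, of the first n observations
   X 0, ..., X (n - 1). *)
definition empirical_measure :: "'a measure \<Rightarrow> (nat \<Rightarrow> 'w \<Rightarrow> 'a) \<Rightarrow> nat \<Rightarrow> 'w \<Rightarrow> 'a measure" where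
  "empirical_measure N X n \<omega> = distr (uniform_count_measure {..<n}) N (\<lambda>i. X i \<omega>)"

definition argmin_set :: "'a set \<Rightarrow> ('a \<Rightarrow> 'b::ord) \<Rightarrow> 'a set" where
  "argmin_set S F = {x. is_arg_min F (\<lambda>x. x \<in> S) x}"

(* Valued in ennreal, so that the infimum over an empty B is \<infinity> and the supremum over
   an empty A is 0. *)
definition inclusion_distance :: "'a::metric_space set \<Rightarrow> 'a set \<Rightarrow> ennreal" where
  "inclusion_distance A B = (SUP x\<in>A. INF y\<in>B. ennreal (dist x y))"

(* Convergence in outer probability to a finite limit c. The variables Y n need not be
   measurable and may take infinite values. *)
definition tendsto_outer_prob :: "'w measure \<Rightarrow> (nat \<Rightarrow> 'w \<Rightarrow> ereal) \<Rightarrow> ereal \<Rightarrow> bool" where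
  "tendsto_outer_prob M Y c \<longleftrightarrow>
     (\<forall>\<eta>>0. (\<lambda>n. outer_measure_of M {\<omega>\<in>space M. ereal \<eta> < \<bar>Y n \<omega> - c\<bar>}) \<longlonglongrightarrow> 0)"

end

theory Submission
  imports Defs
begin

text \<open>
  Convexity and \<open>f(1) = f'(1) = 0\<close>, \<open>f''(1) = 2\<close> give \<open>f(t) \<ge> c min(|t - 1|, (t - 1)\<^sup>2)\<close>.
  Under the empirical distribution every sample point has mass at least \<open>1/n\<close>, so the
  likelihood ratios of the distributions in the divergence ball of radius \<open>\<rho>/n\<close> are bounded
  uniformly in \<open>n\<close> and differ from 1 by \<open>O(1 / sqrt n)\<close> on average. Truncating the loss, the worst-case
  risk at a fixed \<open>x\<close> therefore differs from the empirical mean by a vanishing amount plus the mean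
  of the tail, and the weak law of large numbers gives convergence in probability to the risk.

  The worst-case risk is almost surely convex in \<open>x\<close>. A convex function that is close to the
  limit \<open>F\<close> at finitely many suitable points is bounded from below, uniformly on a compact convex
  set and up to its relative boundary, by local lower bounds of \<open>F\<close>: one shrinks the set
  towards a relative interior point, uses nets there, and extrapolates outwards by convexity. Together
  with the lower semicontinuity of \<open>F\<close> (Fatou's lemma) this localizes both the minimal value and
  the minimizers; coercivity confines the argument to a ball.
\<close>

section \<open>Convex functions determined approximately by finitely many values\<close>

lemma convex_lower_bound_from_finitely_many_points:
  fixes K :: "'a::euclidean_space set" and F :: "'a \<Rightarrow> real"
  assumes K: "compact K" "convex K" "K \<noteq> {}" and v: "\<And>x. x \<in> K \<Longrightarrow> v \<le> F x"
    and \<theta>: "\<theta> > 0" and \<eta>: "\<eta> > 0"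
  obtains A \<delta> where "finite A" "A \<subseteq> K" "\<delta> > 0"
    "\<And>G x \<alpha>. convex_on K G \<Longrightarrow> (\<And>a. a \<in> A \<Longrightarrow> \<bar>G a - F a\<bar> \<le> \<delta>) \<Longrightarrow> x \<in> K \<Longrightarrow> v \<le> \<alpha> \<Longrightarrow>
       (\<And>a. a \<in> K \<Longrightarrow> dist a x \<le> \<eta> \<Longrightarrow> \<alpha> \<le> F a) \<Longrightarrow> \<alpha> - \<theta> \<le> G x"
proof -
  \<comment> \<open>The simplex spanned by an affine basis has nonempty interior relative to the
    affine hull of \<open>K\<close>, and a convex function on it is bounded above by its values at
    the finitely many vertices.\<close>
  obtain B where B: "B \<subseteq> K" "\<not> affine_dependent B" "affine hull K = affine hull B"
    using affine_basis_exists[of K] by auto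
  have finB: "finite B" using B(2) by (rule aff_independent_finite)
  have Bne: "B \<noteq> {}" using B(3) K(3) by (metis affine_hull_eq_empty)
  have convB: "convex hull B \<subseteq> K" using B(1) K(2) by (rule hull_minimal)
  have "rel_interior (convex hull B) \<noteq> {}"
    using Bne by (simp add: rel_interior_eq_empty)
  then obtain y where "y \<in> rel_interior (convex hull B)" by auto
  then obtain r where yB: "y \<in> convex hull B" and r: "r > 0"
    and ball: "ball y r \<inter> affine hull B \<subseteq> convex hull B"
    unfolding mem_rel_interior_ball by auto
  have yK: "y \<in> K" using yB convB by auto
  have yaff: "y \<in> affine hull B" using yB convex_hull_subset_affine_hull by blast
  \<comment> \<open>Auxiliary points are produced by adding multiples of differences of points of
    \<open>K\<close>; they stay in the affine hull, where \<open>ball\<close> can be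
    applied.\<close>
  have shift: "u + s *\<^sub>R (a - b) \<in> affine hull B" if "u \<in> affine hull B" "a \<in> K" "b \<in> K" for u s a b
  proof -
    have "a \<in> affine hull B" "b \<in> affine hull B"
      using that B(3) hull_subset[of K affine] by auto
    from mem_affine_3_minus[OF affine_affine_hull that(1) this] show ?thesis .
  qed
  obtain D where D: "D > 0" "\<And>a b. a \<in> K \<Longrightarrow> b \<in> K \<Longrightarrow> dist a b \<le> D"
  proof
    show "diameter K + 1 > 0" using diameter_ge_0[OF compact_imp_bounded[OF K(1)]] by simp
    show "dist a b \<le> diameter K + 1" if "a \<in> K" "b \<in> K" for a b
      using diameter_bounded_bound[OF compact_imp_bounded[OF K(1)] that] by simp
  qed
  have net: "\<exists>W. finite W \<and> W \<subseteq> K \<and> (\<forall>x\<in>K. \<exists>w\<in>W. dist w x < e)" if "e > 0" for e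
  proof -
    obtain W where "finite W" "W \<subseteq> K" "K \<subseteq> (\<Union>x\<in>W. ball x e)"
      using seq_compact_imp_totally_bounded[OF compact_imp_seq_compact[OF K(1)]] \<open>e > 0\<close> by meson
    then show ?thesis by (intro exI[of _ W]) (auto simp: subset_eq)
  qed
  \<comment> \<open>The second bound limits the price of returning from \<open>z\<close> to
    \<open>x\<close> to \<open>\<theta>/4\<close>, with \<open>F y + 1\<close> as an upper bound for
    \<open>G y\<close>; the third keeps the displacement towards \<open>y\<close> below
    \<open>\<eta>/2\<close>; \<open>1/2\<close> is what the closing contradiction tolerates.\<close>
  define t where "t = min (1/2) (min (\<theta> / (4 * (F y + 1 - v))) (\<eta> / (2 * D)))"
  have Fy: "F y + 1 - v > 0" using v[OF yK] by simp
  have t: "0 < t" "t \<le> 1/2" "t * (F y + 1 - v) \<le> \<theta>/4" "t * D \<le> \<eta>/2"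
  proof -
    show "0 < t" using Fy \<theta> \<eta> D(1) by (simp add: t_def)
    show "t \<le> 1/2" unfolding t_def by (rule min.cobounded1)
    have "t \<le> \<theta> / (4 * (F y + 1 - v))" "t \<le> \<eta> / (2 * D)" by (auto simp: t_def)
    then show "t * (F y + 1 - v) \<le> \<theta>/4" "t * D \<le> \<eta>/2"
      using Fy D(1) by (auto simp: field_simps)
  qed
  obtain W0 where W0: "finite W0" "W0 \<subseteq> K" "\<And>x. x \<in> K \<Longrightarrow> \<exists>w\<in>W0. dist w x < t * r / 2"
    using net[of "t * r / 2"] t(1) r by auto
  define m where "m = Max (F ` (W0 \<union> B)) + 1"
  have m: "F a + 1 \<le> m" if "a \<in> W0 \<union> B" for a
    unfolding m_def using that W0(1) finB by auto
  have mv: "v \<le> m" using Bne m v B(1) by fastforce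
  \<comment> \<open>The coarse net must precede the fine one: it bounds \<open>G\<close> from above independently of \<open>c\<close>,
    and the mesh of the fine net depends on \<open>c\<close>.\<close>
  have upper: "(1-t) *\<^sub>R x + t *\<^sub>R u \<in> K \<and> G ((1-t) *\<^sub>R x + t *\<^sub>R u) \<le> m"
    if G: "convex_on K G" "\<And>a. a \<in> W0 \<union> B \<Longrightarrow> G a \<le> F a + 1"
      and x: "x \<in> K" and u: "u \<in> affine hull B" "dist u y < r/2" for G x u
  proof -
    obtain w where w: "w \<in> W0" "dist w x < t * r / 2" using W0(3)[OF x] by auto
    then have wK: "w \<in> K" using W0(2) by auto
    \<comment> \<open>\<open>q\<close> solves (1-t) x + t u = (1-t) w + t q: the error of the net
      approximation \<open>w\<close> of \<open>x\<close> is moved into the second point. The mesh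
      \<open>t * r / 2\<close> keeps \<open>q\<close> in the ball of radius \<open>r\<close> about
      \<open>y\<close>, hence in the simplex, where \<open>G\<close> is at most
      \<open>m\<close>.\<close>
    define q where "q = u + ((1-t)/t) *\<^sub>R (x - w)"
    have "q \<in> affine hull B" unfolding q_def by (rule shift[OF u(1) x wK])
    moreover have "dist y q < r"
    proof -
      have "dist q u = (1-t)/t * dist w x" using t by (simp add: q_def dist_norm norm_minus_commute)
      also have "\<dots> \<le> 1/t * dist w x" using t by (intro mult_right_mono divide_right_mono) auto
      also have "\<dots> < r/2" using w(2) t(1) by (simp add: field_simps)
      finally show ?thesis using u(2) dist_triangle[of q y u] by (simp add: dist_commute)
    qed
    ultimately have q: "q \<in> convex hull B" using ball by auto
    have "convex_on (convex hull B) G" using G(1) convB by (rule convex_on_subset) simp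
    moreover have "\<forall>b\<in>B. G b \<le> m" using G(2) m by fastforce
    ultimately have Gq: "G q \<le> m" using q convex_on_convex_hull_bound by blast
    have Gw: "G w \<le> m" using G(2) m w(1) by fastforce
    have eq: "(1-t) *\<^sub>R x + t *\<^sub>R u = (1-t) *\<^sub>R w + t *\<^sub>R q"
    proof -
      have "t *\<^sub>R q = t *\<^sub>R u + (1-t) *\<^sub>R (x - w)" using t(1) by (simp add: q_def scaleR_add_right)
      then show ?thesis by (simp add: algebra_simps)
    qed
    have "G ((1-t) *\<^sub>R w + t *\<^sub>R q) \<le> (1-t) * G w + t * G q"
      using convex_onD[OF G(1), of t w q] t q convB wK by auto
    also have "\<dots> \<le> (1-t) * m + t * m" using t Gq Gw by (intro add_mono mult_left_mono) auto
    finally have "G ((1-t) *\<^sub>R w + t *\<^sub>R q) \<le> m" by (simp add: algebra_simps)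
    moreover have "(1-t) *\<^sub>R w + t *\<^sub>R q \<in> K"
      using convexD_alt[OF K(2) wK, of q t] q convB t by auto
    ultimately show ?thesis using eq by simp
  qed
  \<comment> \<open>\<open>c\<close> is the extrapolation ratio: \<open>a\<close> will divide the
    segment from \<open>z\<close> to \<open>b\<close> so that a lower bound at \<open>a\<close>
    passes to \<open>z\<close> with loss at most \<open>(m - v + 1) / c\<close> besides
    \<open>\<delta>\<close>.\<close>
  define c where "c = max 1 (8 * (m - v + 1) / \<theta>)"
  have c: "c \<ge> 1" "(m - v + 1) / c \<le> \<theta> / 8"
  proof -
    show "c \<ge> 1" by (simp add: c_def)
    have "8 * (m - v + 1) / \<theta> \<le> c" by (simp add: c_def)
    then show "(m - v + 1) / c \<le> \<theta> / 8" using \<theta> \<open>c \<ge> 1\<close> by (simp add: field_simps)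
  qed
  \<comment> \<open>The second bound compensates the magnification by \<open>c / t\<close> in the
    definition of \<open>u\<close> below, so that \<open>u\<close> stays within \<open>r/2\<close>
    of \<open>y\<close>.\<close>
  define e where "e = min (\<eta>/2) (t * r / (4 * c))"
  have e: "e > 0" "e \<le> \<eta>/2" "c * e / t \<le> r/4"
  proof -
    show "e > 0" "e \<le> \<eta>/2" using \<eta> t r c by (auto simp: e_def)
    have "e \<le> t * r / (4 * c)" by (simp add: e_def)
    then show "c * e / t \<le> r/4" using t c by (simp add: field_simps)
  qed
  obtain W where W: "finite W" "W \<subseteq> K" "\<And>x. x \<in> K \<Longrightarrow> \<exists>w\<in>W. dist w x < e"
    using net[OF e(1)] by auto
  \<comment> \<open>\<open>W0\<close>, \<open>B\<close> and \<open>y\<close> serve the upper bounds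
    on \<open>G\<close>; the shrunken fine net serves the lower bounds.\<close>
  define A where "A = W0 \<union> B \<union> {y} \<union> (\<lambda>w. (1-t) *\<^sub>R w + t *\<^sub>R y) ` W"
  define \<delta> where "\<delta> = min 1 (\<theta>/8)"
  have shrunk: "(1-t) *\<^sub>R w + t *\<^sub>R y \<in> K" if "w \<in> K" for w
    using convexD_alt[OF K(2) that yK, of t] t by auto
  show thesis
  proof (rule that[of A \<delta>])
    show "finite A" using W0(1) finB W(1) by (simp add: A_def)
    show "A \<subseteq> K" using W0(2) B(1) yK W(2) shrunk by (auto simp: A_def)
    show "\<delta> > 0" using \<theta> by (simp add: \<delta>_def)
    fix G x \<alpha>
    assume G: "convex_on K G" and near: "\<And>a. a \<in> A \<Longrightarrow> \<bar>G a - F a\<bar> \<le> \<delta>"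
      and x: "x \<in> K" and \<alpha>: "v \<le> \<alpha>" and low: "\<And>a. a \<in> K \<Longrightarrow> dist a x \<le> \<eta> \<Longrightarrow> \<alpha> \<le> F a"
    have G1: "G a \<le> F a + 1" if "a \<in> A" for a using near[OF that] by (auto simp: \<delta>_def)
    obtain w where w: "w \<in> W" "dist w x < e" using W(3)[OF x] by auto
    have wK: "w \<in> K" using w W(2) by auto
    \<comment> \<open>\<open>b\<close> is chosen so that \<open>a\<close> lies between \<open>z\<close> and \<open>b\<close>; convexity then bounds \<open>G z\<close> from below.\<close>
    define z where "z = (1-t) *\<^sub>R x + t *\<^sub>R y"
    define a where "a = (1-t) *\<^sub>R w + t *\<^sub>R y"
    define u where "u = y + (c * (1-t) / t) *\<^sub>R (w - x)"
    define b where "b = (1-t) *\<^sub>R w + t *\<^sub>R u"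
    have zK: "z \<in> K" and aK: "a \<in> K" using shrunk x wK by (auto simp: z_def a_def)
    have u: "u \<in> affine hull B" unfolding u_def by (rule shift[OF yaff wK x])
    have "dist u y = c * (1-t) / t * dist w x" using t c by (simp add: u_def dist_norm)
    also have "\<dots> \<le> c * 1 / t * e" using t c w(2)
      by (intro mult_mono divide_right_mono mult_left_mono) auto
    also have "\<dots> = c * e / t" by simp
    also have "\<dots> \<le> r/4" by (rule e(3))
    also have "\<dots> < r/2" using r by simp
    finally have "dist u y < r/2" .
    then have b: "b \<in> K" "G b \<le> m" using upper[OF G _ wK u] G1 by (auto simp: A_def b_def)
    have ab: "a = (1 - 1/(1+c)) *\<^sub>R z + (1/(1+c)) *\<^sub>R b"
    proof -
      have "(1+c) *\<^sub>R a = c *\<^sub>R z + b"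
      proof -
        have "t *\<^sub>R u = t *\<^sub>R y + (c * (1-t)) *\<^sub>R (w - x)" using t(1) by (simp add: u_def scaleR_add_right)
        then show ?thesis by (simp add: a_def z_def b_def algebra_simps)
      qed
      then have "(1/(1+c)) *\<^sub>R ((1+c) *\<^sub>R a) = (1/(1+c)) *\<^sub>R (c *\<^sub>R z + b)" by simp
      moreover have "1 - 1/(1+c) = c/(1+c)" using c by (simp add: field_simps)
      ultimately show ?thesis using c by (simp add: scaleR_add_right)
    qed
    have Ga: "G a \<le> (1 - 1/(1+c)) * G z + (1/(1+c)) * G b"
      unfolding ab using convex_onD[OF G, of "1/(1+c)" z b] c zK b by auto
    have "(1+c) * G a \<le> (1+c) * ((1 - 1/(1+c)) * G z + (1/(1+c)) * G b)"
      using Ga c by (intro mult_left_mono) auto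
    also have "\<dots> = c * G z + G b"
    proof -
      have "(1+c) * (1 - 1/(1+c)) = c" "(1+c) * (1/(1+c)) = 1" using c by (auto simp: field_simps)
      then show ?thesis by (simp only: distrib_left mult.assoc[symmetric] mult_1_left)
    qed
    finally have Gz: "(1+c) * G a \<le> c * G z + m" using b by simp
    have "dist a x \<le> dist a w + dist w x" by (rule dist_triangle)
    also have "dist a w = t * dist y w"
    proof -
      have "a - w = t *\<^sub>R (y - w)" by (simp add: a_def algebra_simps)
      then show ?thesis using t by (simp add: dist_norm)
    qed
    also have "t * dist y w \<le> t * D" using D(2)[OF yK wK] t by simp
    finally have "dist a x \<le> \<eta>" using t w e by linarith
    then have "\<alpha> \<le> F a" using low aK by auto
    moreover have "a \<in> A" using w by (auto simp: A_def a_def)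
    ultimately have Ga2: "\<alpha> - \<delta> \<le> G a" using near[of a] by auto
    have "G z \<ge> \<alpha> - \<theta>/4"
    proof -
      have "c * G z \<ge> (1+c) * (\<alpha> - \<delta>) - m"
        using Gz mult_left_mono[OF Ga2, of "1+c"] c by linarith
      also have "(1+c) * (\<alpha> - \<delta>) - m = c * (\<alpha> - \<delta>) - (m - \<alpha> + \<delta>)" by (simp add: algebra_simps)
      also have "\<dots> \<ge> c * (\<alpha> - \<delta>) - (m - v + 1)" using \<alpha> by (simp add: \<delta>_def)
      also have "c * (\<alpha> - \<delta>) - (m - v + 1) = c * (\<alpha> - \<delta> - (m - v + 1)/c)" using c by (simp add: field_simps)
      finally have "G z \<ge> \<alpha> - \<delta> - (m - v + 1)/c" using c by simp
      moreover have "\<delta> \<le> \<theta>/8" by (simp add: \<delta>_def)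
      ultimately show ?thesis using c(2) by linarith
    qed
    moreover have "G z \<le> (1-t) * G x + t * G y"
      unfolding z_def using convex_onD[OF G, of t x y] t x yK by auto
    moreover have "t * G y \<le> t * (F y + 1)" using G1[of y] t by (intro mult_left_mono) (auto simp: A_def)
    ultimately have *: "\<alpha> - \<theta>/4 \<le> (1-t) * G x + t * (F y + 1)" by linarith
    show "\<alpha> - \<theta> \<le> G x"
    proof (rule ccontr)
      assume "\<not> ?thesis"
      then have "(1-t) * G x < (1-t) * (\<alpha> - \<theta>)" using t by (intro mult_strict_left_mono) auto
      moreover have "t * v \<le> t * \<alpha>" using \<alpha> t by simp
      moreover have "t * \<theta> \<le> 1/2 * \<theta>" using t \<theta> by (intro mult_right_mono) auto
      moreover have "(1-t) * (\<alpha> - \<theta>) = \<alpha> - \<theta> - t * \<alpha> + t * \<theta>"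
        "t * (F y + 1) = t * (F y + 1 - v) + t * v" by (simp_all add: algebra_simps)
      ultimately show False using * t(3) \<theta> by linarith
    qed
  qed
qed

text \<open>The previous lemma applies on the part \<open>K\<close> of \<open>X\<close> in a ball
  around a minimizer \<open>x0\<close>. Outside this ball no uniform approximation is required: a
  convex \<open>G\<close> that is at least as large on the sphere as at \<open>x0\<close> cannot
  drop below that level further out on the same ray.\<close>

lemma convex_near_minimization_stability:
  fixes X S :: "'a::euclidean_space set" and F :: "'a \<Rightarrow> real"
  assumes X: "closed X" "convex X" and S: "S \<subseteq> X" "S \<noteq> {}" "bounded S"
    and v: "\<And>x. x \<in> X \<Longrightarrow> v \<le> F x" "\<And>x. x \<in> S \<Longrightarrow> F x = v"
    and sep: "\<And>\<eta>. \<eta> > 0 \<Longrightarrow> \<exists>\<gamma>>0. \<forall>x\<in>X. \<eta> \<le> infdist x S \<longrightarrow> v + \<gamma> \<le> F x"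
    and \<eta>: "\<eta> > 0"
  obtains A \<delta> where "finite A" "A \<subseteq> X" "\<delta> > 0"
    "\<And>G. convex_on X G \<Longrightarrow> (\<And>a. a \<in> A \<Longrightarrow> \<bar>G a - F a\<bar> \<le> \<delta>) \<Longrightarrow>
       (\<forall>x\<in>X. v - \<eta> \<le> G x) \<and> (\<exists>x\<in>X. G x \<le> v + \<eta>) \<and>
       (\<forall>x\<in>X. (\<forall>z\<in>X. G x \<le> G z) \<longrightarrow> infdist x S < \<eta>)"
proof -
  obtain x0 where x0: "x0 \<in> S" using S by auto
  obtain R0 where R0: "S \<subseteq> cball x0 R0" using S(3) unfolding bounded_any_center[of S x0] by (auto simp: subset_eq)
  \<comment> \<open>The margin \<open>\<eta>\<close> over \<open>R0\<close> makes every point on or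
    beyond the sphere of radius \<open>R\<close> at least \<open>\<eta>\<close> away from
    \<open>S\<close>.\<close>
  define R where "R = R0 + \<eta>"
  have R0nn: "R0 \<ge> 0" using R0 x0 by auto
  have Rpos: "R > 0" using R0nn \<eta> by (simp add: R_def)
  have far: "\<eta> \<le> infdist x S" if "R \<le> dist x0 x" for x
    unfolding infdist_notempty[OF S(2)]
  proof (rule cINF_greatest[OF S(2)])
    fix s assume "s \<in> S"
    then have "dist x0 s \<le> R0" using R0 by auto
    then show "\<eta> \<le> dist x s" using that dist_triangle[of x0 x s] by (simp add: R_def dist_commute)
  qed
  \<comment> \<open>The gap is taken at distance \<open>\<eta>/2\<close>, because points within
    \<open>\<eta>/2\<close> of an \<open>\<eta>\<close>-far point are still
    \<open>\<eta>/2\<close>-far from \<open>S\<close>.\<close>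
  obtain \<gamma> where \<gamma>: "\<gamma> > 0" "\<And>x. x \<in> X \<Longrightarrow> \<eta>/2 \<le> infdist x S \<Longrightarrow> v + \<gamma> \<le> F x"
    using sep[of "\<eta>/2"] \<eta> by auto
  \<comment> \<open>With \<open>\<theta> \<le> \<gamma>/4\<close> the lower bound
    \<open>v + \<gamma> - \<theta>\<close> for far points strictly exceeds the upper bound
    \<open>v + \<theta>\<close> for \<open>G x0\<close>.\<close>
  define \<theta> where "\<theta> = min \<eta> (\<gamma>/4)"
  have \<theta>: "\<theta> > 0" "\<theta> \<le> \<eta>" "\<theta> \<le> \<gamma>/4" using \<gamma> \<eta> by (auto simp: \<theta>_def)
  define K where "K = X \<inter> cball x0 R"
  have K: "compact K" "convex K" "K \<noteq> {}"
    using X x0 S(1) Rpos by (auto simp: K_def intro!: closed_Int_compact convex_Int)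
  have vK: "v \<le> F x" if "x \<in> K" for x using that v by (auto simp: K_def)
  have \<eta>2: "\<eta>/2 > 0" using \<eta> by simp
  obtain A \<delta> where A: "finite A" "A \<subseteq> K" "\<delta> > 0"
    and low: "\<And>G x \<alpha>. convex_on K G \<Longrightarrow> (\<And>a. a \<in> A \<Longrightarrow> \<bar>G a - F a\<bar> \<le> \<delta>) \<Longrightarrow> x \<in> K \<Longrightarrow> v \<le> \<alpha> \<Longrightarrow>
       (\<And>a. a \<in> K \<Longrightarrow> dist a x \<le> \<eta>/2 \<Longrightarrow> \<alpha> \<le> F a) \<Longrightarrow> \<alpha> - \<theta> \<le> G x"
    using convex_lower_bound_from_finitely_many_points[of K v F \<theta> "\<eta>/2", OF K vK \<theta>(1) \<eta>2] by metis
  show thesis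
  proof (rule that[of "insert x0 A" "min \<delta> \<theta>"])
    show "finite (insert x0 A)" "insert x0 A \<subseteq> X" "min \<delta> \<theta> > 0"
      using A \<theta> x0 S by (auto simp: K_def)
    fix G assume G: "convex_on X G" and near: "\<And>a. a \<in> insert x0 A \<Longrightarrow> \<bar>G a - F a\<bar> \<le> min \<delta> \<theta>"
    have GK: "convex_on K G" using G by (rule convex_on_subset) (use K in \<open>auto simp: K_def\<close>)
    have Gx0: "G x0 \<le> v + \<theta>" using near[of x0] v(2)[OF x0] by auto
    have nearA: "\<bar>G a - F a\<bar> \<le> \<delta>" if "a \<in> A" for a using near[of a] that by auto
    have inside: "v - \<theta> \<le> G x" if "x \<in> K" for x
      using low[OF GK nearA that, of v] vK by auto
    have gapK: "v + \<gamma> - \<theta> \<le> G x" if "x \<in> K" "\<eta> \<le> infdist x S" for x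
    proof (rule low[OF GK nearA that(1)])
      show "v \<le> v + \<gamma>" using \<gamma> by simp
      fix a assume a: "a \<in> K" "dist a x \<le> \<eta>/2"
      have "infdist x S \<le> infdist a S + dist x a" by (rule infdist_triangle)
      then have "\<eta>/2 \<le> infdist a S" using a that by (simp add: dist_commute)
      then show "v + \<gamma> \<le> F a" using \<gamma>(2) a by (auto simp: K_def)
    qed
    have gap: "v + \<gamma> - \<theta> \<le> G x" if x: "x \<in> X" "\<eta> \<le> infdist x S" for x
    proof (cases "x \<in> K")
      case True then show ?thesis using gapK x by auto
    next
      case False
      then have d: "dist x0 x > R" using x by (auto simp: K_def)
      define s where "s = R / dist x0 x"
      have s: "0 < s" "s < 1"
      proof -
        have "dist x0 x > 0" using d Rpos by linarith
        then show "0 < s" "s < 1" using d Rpos unfolding s_def by (simp_all only: divide_pos_pos) (simp add: divide_less_eq)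
      qed
      \<comment> \<open>\<open>p\<close> is the point where the segment from \<open>x0\<close> to
        \<open>x\<close> crosses the sphere of radius \<open>R\<close>.\<close>
      define p where "p = (1-s) *\<^sub>R x0 + s *\<^sub>R x"
      have x0X: "x0 \<in> X" using x0 S by auto
      have "p - x0 = s *\<^sub>R (x - x0)" by (simp add: p_def algebra_simps)
      then have "dist x0 p = s * dist x0 x" using s by (simp add: dist_norm norm_minus_commute)
      also have "\<dots> = R" using d Rpos by (auto simp add: s_def)
      finally have dp: "dist x0 p = R" .
      have "p \<in> X" unfolding p_def using convexD_alt[OF X(2) x0X x(1), of s] s by simp
      then have "v + \<gamma> - \<theta> \<le> G p" using gapK far dp by (auto simp: K_def)
      moreover have "G p \<le> (1-s) * G x0 + s * G x"
        unfolding p_def using convex_onD[OF G, of s x0 x] s x0X x by auto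
      moreover have "(1-s) * G x0 \<le> (1-s) * (v + \<gamma> - \<theta>)"
        using Gx0 s \<theta> \<gamma> by (intro mult_left_mono) auto
      ultimately have "s * (v + \<gamma> - \<theta>) \<le> s * G x" by (simp add: algebra_simps)
      then show ?thesis using s by simp
    qed
    have "v - \<eta> \<le> G x" if "x \<in> X" for x
      using inside[of x] gap[of x] far[of x] that \<theta> \<gamma> by (cases "x \<in> K") (auto simp: K_def)
    moreover have "G x0 \<le> v + \<eta>" using Gx0 \<theta> by simp
    moreover have "infdist x S < \<eta>" if "x \<in> X" "\<forall>z\<in>X. G x \<le> G z" for x
    proof (rule ccontr)
      assume "\<not> ?thesis"
      then have "v + \<gamma> - \<theta> \<le> G x0" using gap[of x] that x0 S by fastforce
      then show False using Gx0 \<theta> \<gamma> by simp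
    qed
    ultimately show "(\<forall>x\<in>X. v - \<eta> \<le> G x) \<and> (\<exists>x\<in>X. G x \<le> v + \<eta>) \<and>
       (\<forall>x\<in>X. (\<forall>z\<in>X. G x \<le> G z) \<longrightarrow> infdist x S < \<eta>)"
      using x0 S by auto
  qed
qed

section \<open>Weak law of large numbers\<close>

lemma integral_tail_tendsto_0:
  fixes h :: "'a \<Rightarrow> real"
  assumes "integrable N h"
  shows "(\<lambda>K::nat. \<integral>s. (if real K < \<bar>h s\<bar> then \<bar>h s\<bar> else 0) \<partial>N) \<longlonglongrightarrow> 0"
proof -
  note [measurable] = borel_measurable_integrable[OF assms]
  have "(\<lambda>K::nat. \<integral>s. (if real K < \<bar>h s\<bar> then \<bar>h s\<bar> else 0) \<partial>N) \<longlonglongrightarrow> (\<integral>s. 0 \<partial>N)"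
  proof (rule integral_dominated_convergence[where w = "\<lambda>s. \<bar>h s\<bar>"])
    show "AE s in N. (\<lambda>K::nat. if real K < \<bar>h s\<bar> then \<bar>h s\<bar> else 0) \<longlonglongrightarrow> 0"
    proof (rule AE_I2)
      fix s
      have "\<forall>\<^sub>F K in sequentially. \<bar>h s\<bar> \<le> real K"
        using eventually_ge_at_top[of "nat \<lceil>\<bar>h s\<bar>\<rceil>"] by eventually_elim linarith
      then have "\<forall>\<^sub>F K in sequentially. (if real K < \<bar>h s\<bar> then \<bar>h s\<bar> else 0) = 0"
        by eventually_elim auto
      then show "(\<lambda>K::nat. if real K < \<bar>h s\<bar> then \<bar>h s\<bar> else 0) \<longlonglongrightarrow> 0"
        by (rule tendsto_eventually)
    qed
  qed (use assms in auto)
  then show ?thesis by simp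
qed

context prob_space
begin

text \<open>Hoeffding's inequality bounds the deviation probability by a term exponentially small in
  \<open>n\<close>.\<close>

lemma weak_law_of_large_numbers_bounded:
  fixes h :: "'b \<Rightarrow> real"
  assumes indep: "indep_vars (\<lambda>_. N) \<xi> (UNIV::nat set)" and distr: "\<And>i. distr M N (\<xi> i) = N"
    and h[measurable]: "h \<in> borel_measurable N" and K: "\<And>s. \<bar>h s\<bar> \<le> K" and \<delta>: "\<delta> > 0"
  shows "(\<lambda>n. prob {\<omega>\<in>space M. \<delta> \<le> \<bar>(\<Sum>i<n. h (\<xi> i \<omega>)) / real n - (\<integral>s. h s \<partial>N)\<bar>}) \<longlonglongrightarrow> 0"
proof -
  have \<xi>[measurable]: "\<xi> i \<in> measurable M N" for i
    using indep unfolding indep_vars_def2 by simp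
  have K0: "K \<ge> 0" using K[of undefined] by linarith
  have bound: "prob {\<omega>\<in>space M. \<delta> \<le> \<bar>(\<Sum>i<n. h (\<xi> i \<omega>)) / real n - (\<integral>s. h s \<partial>N)\<bar>}
      \<le> 2 * exp (-2 * real n * \<delta>\<^sup>2 / (K + 1 + K)\<^sup>2)" if "n > 0" for n
  proof -
    have mean: "expectation (\<lambda>\<omega>. h (\<xi> 0 \<omega>)) = (\<integral>s. h s \<partial>N)"
      using integral_distr[OF \<xi>[of 0] h] distr[of 0] by simp
    \<comment> \<open>The interval from \<open>-K\<close> to \<open>K + 1\<close> has positive
      length even when \<open>K = 0\<close>.\<close>
    interpret Hoeffding_ineq_iid M "{..<n}" "\<lambda>i \<omega>. h (\<xi> i \<omega>)" "\<lambda>\<omega>. h (\<xi> 0 \<omega>)" "-K" "K+1"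
      "expectation (\<lambda>\<omega>. h (\<xi> 0 \<omega>))"
    proof unfold_locales
      show "indep_vars (\<lambda>_. borel) (\<lambda>i \<omega>. h (\<xi> i \<omega>)) {..<n}"
        using indep_vars_compose2[OF indep_vars_subset[OF indep, of "{..<n}"], of "\<lambda>_. h" "\<lambda>_. borel"] by simp
      fix i
      have "distr M borel (\<lambda>\<omega>. h (\<xi> j \<omega>)) = distr N borel h" for j
        using distr_distr[OF h \<xi>[of j]] distr[of j] by (simp add: comp_def)
      then show "distr M borel (\<lambda>\<omega>. h (\<xi> i \<omega>)) = distr M borel (\<lambda>\<omega>. h (\<xi> 0 \<omega>))" by simp
      have "h s \<in> {-K..K+1}" for s using K[of s] by auto
      then show "AE \<omega> in M. h (\<xi> 0 \<omega>) \<in> {-K..K+1}" by simp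
    qed auto
    show ?thesis
      using Hoeffding_ineq_abs_ge'[of \<delta>] \<delta> K0 that by (simp add: mean lessThan_empty_iff)
  qed
  have "(\<lambda>n. 2 * exp (-2 * real n * \<delta>\<^sup>2 / (K + 1 + K)\<^sup>2)) \<longlonglongrightarrow> 2 * 0"
  proof (intro tendsto_mult tendsto_const filterlim_compose[OF exp_at_bot])
    have p: "2 * \<delta>\<^sup>2 / (K + 1 + K)\<^sup>2 > 0" using \<delta> K0 by simp
    have "filterlim (\<lambda>n. - ((2 * \<delta>\<^sup>2 / (K + 1 + K)\<^sup>2) * real n)) at_bot sequentially"
      unfolding filterlim_uminus_at_top[symmetric]
      by (rule filterlim_tendsto_pos_mult_at_top[OF tendsto_const p filterlim_real_sequentially])
    then show "filterlim (\<lambda>n. -2 * real n * \<delta>\<^sup>2 / (K + 1 + K)\<^sup>2) at_bot sequentially"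
      by (simp add: mult.commute mult.left_commute)
  qed
  then have lim: "(\<lambda>n. 2 * exp (-2 * real n * \<delta>\<^sup>2 / (K + 1 + K)\<^sup>2)) \<longlonglongrightarrow> 0" by simp
  have ev: "\<forall>\<^sub>F n in sequentially. norm (prob {\<omega>\<in>space M. \<delta> \<le> \<bar>(\<Sum>i<n. h (\<xi> i \<omega>)) / real n - (\<integral>s. h s \<partial>N)\<bar>})
      \<le> 2 * exp (-2 * real n * \<delta>\<^sup>2 / (K + 1 + K)\<^sup>2)"
    using eventually_gt_at_top[of 0] by eventually_elim (use bound in auto)
  show ?thesis by (rule Lim_null_comparison[OF ev lim])
qed

text \<open>Truncation splits \<open>h\<close> into a bounded part \<open>b\<close>, covered by the
  previous lemma, and a tail whose absolute value \<open>k\<close> has small mean; Markov's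
  inequality controls the sample average of \<open>k\<close>. Only a first moment enters.\<close>

lemma weak_law_of_large_numbers:
  fixes h :: "'b \<Rightarrow> real"
  assumes indep: "indep_vars (\<lambda>_. N) \<xi> (UNIV::nat set)" and distr: "\<And>i. distr M N (\<xi> i) = N"
    and h: "integrable N h" and \<delta>: "\<delta> > 0"
  shows "(\<lambda>n. prob {\<omega>\<in>space M. \<delta> \<le> \<bar>(\<Sum>i<n. h (\<xi> i \<omega>)) / real n - (\<integral>s. h s \<partial>N)\<bar>}) \<longlonglongrightarrow> 0"
proof (rule LIMSEQ_I)
  fix e :: real assume e: "e > 0"
  have \<xi>[measurable]: "\<xi> i \<in> measurable M N" for i
    using indep unfolding indep_vars_def2 by simp
  note hm[measurable] = borel_measurable_integrable[OF h]
  interpret N: prob_space N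
    using prob_space_distr[OF \<xi>[of 0]] distr[of 0] by simp
  \<comment> \<open>\<open>\<delta>/4\<close> bounds the shift of the mean caused by truncation,
    next to \<open>\<delta>/4\<close> for \<open>b\<close> and \<open>\<delta>/2\<close> for
    \<open>k\<close>. The second bound turns Markov's estimate at level \<open>\<delta>/2\<close>
    into \<open>e/4\<close>.\<close>
  define \<tau> where "\<tau> = min (\<delta>/4) (e * \<delta> / 8)"
  have \<tau>: "\<tau> > 0" "\<tau> \<le> \<delta>/4" "\<tau> \<le> e * \<delta> / 8" using \<delta> e by (auto simp: \<tau>_def)
  obtain K :: nat where K: "\<bar>\<integral>s. (if real K < \<bar>h s\<bar> then \<bar>h s\<bar> else 0) \<partial>N\<bar> < \<tau>"
    using LIMSEQ_D[OF integral_tail_tendsto_0[OF h] \<tau>(1)] by fastforce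
  define b where "b s = (if real K < \<bar>h s\<bar> then 0 else h s)" for s
  define k where "k s = (if real K < \<bar>h s\<bar> then \<bar>h s\<bar> else 0)" for s
  have bm[measurable]: "b \<in> borel_measurable N" unfolding b_def[abs_def] by measurable
  have km[measurable]: "k \<in> borel_measurable N" unfolding k_def[abs_def] by measurable
  have k: "integrable N k"
    by (rule Bochner_Integration.integrable_bound[OF h]) (auto simp: k_def)
  have b: "integrable N b"
    by (rule Bochner_Integration.integrable_bound[OF h]) (auto simp: b_def)
  have bk: "\<bar>h s - b s\<bar> = k s" for s by (auto simp: b_def k_def)
  have k0: "k s \<ge> 0" for s by (auto simp: k_def)
  have Ek: "(\<integral>s. k s \<partial>N) < \<tau>" using K unfolding k_def[abs_def] by linarith
  have hb: "\<bar>(\<integral>s. h s \<partial>N) - (\<integral>s. b s \<partial>N)\<bar> \<le> (\<integral>s. k s \<partial>N)"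
    using integral_abs_bound[of N "\<lambda>s. h s - b s"] h b by (simp add: bk)
  have "(\<lambda>n. prob {\<omega>\<in>space M. \<delta>/4 \<le> \<bar>(\<Sum>i<n. b (\<xi> i \<omega>)) / real n - (\<integral>s. b s \<partial>N)\<bar>}) \<longlonglongrightarrow> 0"
    by (rule weak_law_of_large_numbers_bounded[OF indep distr bm, of "real K"]) (use \<delta> in \<open>auto simp: b_def\<close>)
  moreover have "e/2 > 0" using e by simp
  ultimately obtain n0 where n0: "\<And>n. n \<ge> n0 \<Longrightarrow>
      \<bar>prob {\<omega>\<in>space M. \<delta>/4 \<le> \<bar>(\<Sum>i<n. b (\<xi> i \<omega>)) / real n - (\<integral>s. b s \<partial>N)\<bar>}\<bar> < e/2"
    using LIMSEQ_D by fastforce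
  show "\<exists>no. \<forall>n\<ge>no. norm (prob {\<omega>\<in>space M. \<delta> \<le> \<bar>(\<Sum>i<n. h (\<xi> i \<omega>)) / real n - (\<integral>s. h s \<partial>N)\<bar>} - 0) < e"
  proof (intro exI allI impI)
    fix n assume "n \<ge> max 1 n0"
    then have n: "n \<ge> 1" "n \<ge> n0" by auto
    let ?E1 = "{\<omega>\<in>space M. \<delta>/4 \<le> \<bar>(\<Sum>i<n. b (\<xi> i \<omega>)) / real n - (\<integral>s. b s \<partial>N)\<bar>}"
    let ?E2 = "{\<omega>\<in>space M. \<delta>/2 \<le> (\<Sum>i<n. k (\<xi> i \<omega>)) / real n}"
    let ?E = "{\<omega>\<in>space M. \<delta> \<le> \<bar>(\<Sum>i<n. h (\<xi> i \<omega>)) / real n - (\<integral>s. h s \<partial>N)\<bar>}"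
    have "?E \<subseteq> ?E1 \<union> ?E2"
    proof
      fix \<omega> assume \<omega>: "\<omega> \<in> ?E"
      have "\<bar>(\<Sum>i<n. h (\<xi> i \<omega>)) / real n - (\<Sum>i<n. b (\<xi> i \<omega>)) / real n\<bar>
          = \<bar>\<Sum>i<n. h (\<xi> i \<omega>) - b (\<xi> i \<omega>)\<bar> / real n"
        using n by (simp add: sum_subtractf diff_divide_distrib[symmetric])
      also have "\<dots> \<le> (\<Sum>i<n. k (\<xi> i \<omega>)) / real n"
        using sum_abs[of "\<lambda>i. h (\<xi> i \<omega>) - b (\<xi> i \<omega>)" "{..<n}"] by (intro divide_right_mono) (auto simp: bk)
      finally have diff: "\<bar>(\<Sum>i<n. h (\<xi> i \<omega>)) / real n - (\<Sum>i<n. b (\<xi> i \<omega>)) / real n\<bar>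
        \<le> (\<Sum>i<n. k (\<xi> i \<omega>)) / real n" .
      show "\<omega> \<in> ?E1 \<union> ?E2"
      proof (rule ccontr)
        assume "\<omega> \<notin> ?E1 \<union> ?E2"
        then have "\<bar>(\<Sum>i<n. b (\<xi> i \<omega>)) / real n - (\<integral>s. b s \<partial>N)\<bar> < \<delta>/4"
          "(\<Sum>i<n. k (\<xi> i \<omega>)) / real n < \<delta>/2" using \<omega> by auto
        moreover have "\<delta> \<le> \<bar>(\<Sum>i<n. h (\<xi> i \<omega>)) / real n - (\<integral>s. h s \<partial>N)\<bar>" using \<omega> by auto
        ultimately show False using diff hb Ek \<tau>(2) by linarith
      qed
    qed
    then have "prob ?E \<le> prob (?E1 \<union> ?E2)" by (intro finite_measure_mono) auto
    also have "\<dots> \<le> prob ?E1 + prob ?E2" by (rule measure_Un_le) measurable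
    also have "prob ?E2 \<le> (\<integral>\<omega>. (\<Sum>i<n. k (\<xi> i \<omega>)) / real n \<partial>M) / (\<delta>/2)"
    proof (rule integral_Markov_inequality_measure[where A = "space M"])
      have "integrable (distr M N (\<xi> i)) k" for i using k distr by simp
      then have "integrable M (\<lambda>\<omega>. k (\<xi> i \<omega>))" for i
        by (rule integrable_distr[OF \<xi>])
      then show "integrable M (\<lambda>\<omega>. (\<Sum>i<n. k (\<xi> i \<omega>)) / real n)" by simp
    qed (use \<delta> k0 in \<open>auto intro!: sum_nonneg divide_nonneg_nonneg\<close>)
    also have "(\<integral>\<omega>. (\<Sum>i<n. k (\<xi> i \<omega>)) / real n \<partial>M) = (\<integral>s. k s \<partial>N)"
    proof -
      have *: "(\<integral>\<omega>. k (\<xi> i \<omega>) \<partial>M) = (\<integral>s. k s \<partial>N)" for i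
        using integral_distr[OF \<xi>[of i] km] distr[of i] by simp
      have "integrable (distr M N (\<xi> i)) k" for i using k distr by simp
      then have "integrable M (\<lambda>\<omega>. k (\<xi> i \<omega>))" for i
        by (rule integrable_distr[OF \<xi>])
      then show ?thesis using n by (simp add: *)
    qed
    also have "(\<integral>s. k s \<partial>N) / (\<delta>/2) \<le> (e * \<delta> / 8) / (\<delta>/2)"
      using Ek \<tau>(3) \<delta> by (intro divide_right_mono) auto
    also have "\<dots> = e/4" using \<delta> by simp
    finally have "prob ?E \<le> prob ?E1 + e/4" by simp
    also have "\<dots> < e" using n0[OF n(2)] e by linarith
    finally show "norm (prob ?E - 0) < e" by simp
  qed
qed

end

section \<open>Divergence balls around the empirical distribution\<close>

text \<open>Near 1 the second derivative forces quadratic growth. Further away convexity on the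
  segment from 1 to \<open>t\<close>, together with \<open>f 1 = 0\<close>, extends the quadratic
  value at distance \<open>r\<close> to linear growth of slope \<open>r/2\<close>; the minimum
  records both regimes.\<close>

lemma smooth_divergence_function_lower_bound:
  assumes "smooth_divergence_function f"
  obtains c where "c > 0" "\<And>t. t \<ge> 0 \<Longrightarrow> ereal (c * min \<bar>t - 1\<bar> ((t - 1)\<^sup>2)) \<le> f t"
proof -
  define \<phi> where "\<phi> s = real_of_ereal (f s)" for s
  from assms obtain U where fm: "\<And>t. t \<ge> 0 \<Longrightarrow> f t \<noteq> -\<infinity>" and conv: "ereal_convex_on {0..} f"
    and U: "open U" "1 \<in> U" "U \<subseteq> {0..}" "\<And>t. t \<in> U \<Longrightarrow> f t \<noteq> \<infinity>"
    and diff: "\<And>t k. t \<in> U \<Longrightarrow> k < 3 \<Longrightarrow> (deriv ^^ k) \<phi> differentiable (at t)"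
    and f1: "f 1 = 0" "deriv \<phi> 1 = 0" "(deriv ^^ 2) \<phi> 1 = 2"
    unfolding smooth_divergence_function_def \<phi>_def[abs_def] by blast
  have f\<phi>: "f t = ereal (\<phi> t)" if "t \<in> U" for t
    using fm[of t] U(3,4) that by (cases "f t") (auto simp: \<phi>_def)
  have d1: "(\<phi> has_real_derivative deriv \<phi> t) (at t)" if "t \<in> U" for t
    using diff[OF that, of 0] by (simp add: DERIV_deriv_iff_real_differentiable)
  have "(deriv \<phi> has_real_derivative 2) (at 1)"
    using diff[OF U(2), of 1] f1(3) by (simp add: DERIV_deriv_iff_real_differentiable[symmetric] numeral_2_eq_2)
  then have "((\<lambda>h. (deriv \<phi> (1 + h) - deriv \<phi> 1) / h) \<longlongrightarrow> 2) (at 0)"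
    by (simp add: DERIV_def)
  then have "\<forall>\<^sub>F h in at 0. (deriv \<phi> (1 + h) - deriv \<phi> 1) / h > 1"
    by (rule order_tendstoD) simp
  then obtain d where d: "d > 0" "\<And>h. h \<noteq> 0 \<Longrightarrow> \<bar>h\<bar> < d \<Longrightarrow> deriv \<phi> (1 + h) / h > 1"
    using f1(2) by (auto simp: eventually_at dist_real_def)
  obtain r0 where r0: "r0 > 0" "ball 1 r0 \<subseteq> U" using U(1,2) open_contains_ball by blast
  define r where "r = min (1/2) (min (d/2) (r0/2))"
  have r: "r > 0" "r \<le> 1/2" "r < d" "r < r0" using d(1) r0(1) by (auto simp: r_def)
  have inU: "t \<in> U" if "\<bar>t - 1\<bar> \<le> r" for t
    using that r r0(2) by (auto simp: dist_real_def subset_eq)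
  have inner: "(t - 1)\<^sup>2 / 2 \<le> \<phi> t" if t: "\<bar>t - 1\<bar> \<le> r" for t
  proof -
    \<comment> \<open>Since the quotient of \<open>deriv \<phi> s\<close> by \<open>s - 1\<close>
      exceeds 1 near 1, the derivative of \<open>\<psi>\<close> has the sign of
      \<open>s - 1\<close>, and \<open>\<psi>\<close> is minimal at 1.\<close>
    define \<psi> where "\<psi> s = \<phi> s - (s - 1)\<^sup>2 / 2" for s
    have \<psi>1: "\<psi> 1 = 0" using f1(1) by (simp add: \<psi>_def \<phi>_def)
    have D: "(\<psi> has_real_derivative (deriv \<phi> s - (s - 1))) (at s)" if "\<bar>s - 1\<bar> \<le> r" for s
      unfolding \<psi>_def[abs_def] by (auto intro!: derivative_eq_intros d1 inU that simp: field_simps)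
    have sgnd: "deriv \<phi> s / (s - 1) > 1" if "\<bar>s - 1\<bar> \<le> r" "s \<noteq> 1" for s
      using d(2)[of "s - 1"] that r by auto
    have "\<psi> 1 \<le> \<psi> t"
    proof (cases "1 \<le> t")
      case True
      then show ?thesis
      proof (rule DERIV_nonneg_imp_nondecreasing)
        fix s assume s: "1 \<le> s" "s \<le> t"
        have "0 \<le> deriv \<phi> s - (s - 1)"
          using sgnd[of s] s t f1(2) by (cases "s = 1") (auto simp: field_simps)
        then show "\<exists>y. (\<psi> has_real_derivative y) (at s) \<and> 0 \<le> y" using D[of s] s t by auto
      qed
    next
      case False
      then have "t \<le> 1" by simp
      then show ?thesis
      proof (rule DERIV_nonpos_imp_nonincreasing)
        fix s assume s: "t \<le> s" "s \<le> 1"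
        have "deriv \<phi> s - (s - 1) \<le> 0"
          using sgnd[of s] s t f1(2) by (cases "s = 1") (auto simp: field_simps)
        then show "\<exists>y. (\<psi> has_real_derivative y) (at s) \<and> y \<le> 0" using D[of s] s t by auto
      qed
    qed
    then show ?thesis using \<psi>1 by (simp add: \<psi>_def)
  qed
  show thesis
  proof (rule that[of "r/2"])
    show "r/2 > 0" using r by simp
    fix t :: real assume t: "t \<ge> 0"
    show "ereal (r/2 * min \<bar>t - 1\<bar> ((t - 1)\<^sup>2)) \<le> f t"
    proof (cases "\<bar>t - 1\<bar> \<le> r")
      case True
      have "r/2 * min \<bar>t - 1\<bar> ((t - 1)\<^sup>2) \<le> 1/2 * (t - 1)\<^sup>2" using r by (intro mult_mono) auto
      then show ?thesis using inner[OF True] f\<phi>[OF inU[OF True]] by simp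
    next
      case False
      \<comment> \<open>\<open>s\<close> is the point at distance exactly \<open>r\<close> from 1 on
        the segment from 1 to \<open>t\<close>.\<close>
      define q where "q = r / \<bar>t - 1\<bar>"
      define s where "s = 1 + q * (t - 1)"
      have q: "0 < q" "q < 1" using False r by (auto simp: q_def)
      have qt: "q * \<bar>t - 1\<bar> = r" using False r by (auto simp: q_def)
      have "\<bar>s - 1\<bar> = r" using qt q by (simp add: s_def abs_mult)
      then have s: "\<bar>s - 1\<bar> \<le> r" "(s - 1)\<^sup>2 = r\<^sup>2" by (auto simp: power2_eq_iff abs_if split: if_splits)
      have "f s = f ((1-q) *\<^sub>R 1 + q *\<^sub>R t)" by (simp add: s_def algebra_simps)
      also have "\<dots> \<le> ereal (1-q) * f 1 + ereal q * f t"
      proof -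
        have "\<forall>x\<in>{0..}. \<forall>y\<in>{0..}. \<forall>u\<ge>0. \<forall>v\<ge>0. u + v = 1 \<longrightarrow>
            f (u *\<^sub>R x + v *\<^sub>R y) \<le> ereal u * f x + ereal v * f y"
          using conv unfolding ereal_convex_on_def by (rule conjunct2)
        from this[rule_format, of 1 t "1-q" q] show ?thesis using q t by simp
      qed
      finally have "ereal (\<phi> s) \<le> ereal q * f t" using f\<phi>[OF inU[OF s(1)]] f1 by simp
      then have *: "ereal (r\<^sup>2/2) \<le> ereal q * f t" using inner[OF s(1)] s(2)
        by (metis ereal_less_eq(3) order_trans)
      show ?thesis
      proof (cases "f t")
        case (real x)
        then have "r\<^sup>2/2 \<le> q * x" using * by simp
        then have "\<bar>t - 1\<bar> * (r\<^sup>2/2) \<le> \<bar>t - 1\<bar> * (q * x)" by (intro mult_left_mono) auto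
        also have "\<dots> = r * x" using qt by (metis mult.assoc mult.commute)
        finally have "r * (r/2 * \<bar>t - 1\<bar>) \<le> r * x" by (simp add: power2_eq_square mult_ac)
        then have "r/2 * \<bar>t - 1\<bar> \<le> x" using r by simp
        moreover have "r/2 * min \<bar>t - 1\<bar> ((t - 1)\<^sup>2) \<le> r/2 * \<bar>t - 1\<bar>" using r by (intro mult_left_mono) auto
        ultimately show ?thesis using real by simp
      qed (use fm[OF t] in auto)
    qed
  qed
qed

text \<open>One outcome and one sample size are fixed, so that the facts below are deterministic.
  Sums run over observations, which takes care of repeated values; \<open>n_pos\<close> makes the
  empirical measure a probability measure.\<close>

locale empirical_sample =
  fixes N :: "'a measure" and X :: "nat \<Rightarrow> 'w \<Rightarrow> 'a" and n :: nat and \<omega> :: 'w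
  assumes sample_in_space: "\<And>i. X i \<omega> \<in> space N" and n_pos: "n > 0"
begin

abbreviation Q :: "'a measure" where "Q \<equiv> empirical_measure N X n \<omega>"

lemma sets_Q[measurable_cong, simp]: "sets Q = sets N"
  by (simp add: empirical_measure_def)

lemma space_Q[simp]: "space Q = space N"
  by (simp add: empirical_measure_def)

lemma measurable_sample[measurable]: "(\<lambda>i. X i \<omega>) \<in> measurable (uniform_count_measure {..<n}) N"
  by (simp add: measurable_def space_uniform_count_measure sets_uniform_count_measure Pi_def sample_in_space)

lemma prob_space_Q: "prob_space Q"
  unfolding empirical_measure_def
  by (intro prob_space.prob_space_distr prob_space_uniform_count_measure measurable_sample)
     (use n_pos in auto)

lemma nn_integral_Q:
  assumes "u \<in> borel_measurable N"
  shows "(\<integral>\<^sup>+s. u s \<partial>Q) = (\<Sum>i<n. ennreal (1 / real n) * u (X i \<omega>))"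
  unfolding empirical_measure_def
  using nn_integral_distr[OF measurable_sample, of u] assms
  by (simp add: uniform_count_measure_def nn_integral_point_measure_finite)

lemma integral_Q:
  fixes h :: "'a \<Rightarrow> real"
  assumes "h \<in> borel_measurable N"
  shows "(\<integral>s. h s \<partial>Q) = (\<Sum>i<n. h (X i \<omega>)) / real n"
  unfolding empirical_measure_def
  using assms by (simp add: integral_distr integral_uniform_count_measure)

lemma AE_Q:
  assumes "A \<in> sets N" "\<And>i. i < n \<Longrightarrow> X i \<omega> \<notin> A" "{s\<in>space N. \<not> P s} \<subseteq> A"
  shows "AE s in Q. P s"
proof (rule AE_I)
  show "{s \<in> space Q. \<not> P s} \<subseteq> A" using assms(3) by simp
  show "A \<in> sets Q" using assms(1) by simp
  have "emeasure Q A = emeasure (uniform_count_measure {..<n}) ((\<lambda>i. X i \<omega>) -` A \<inter> space (uniform_count_measure {..<n}))"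
    unfolding empirical_measure_def using assms(1) by (rule emeasure_distr[OF measurable_sample])
  also have "(\<lambda>i. X i \<omega>) -` A \<inter> space (uniform_count_measure {..<n}) = {}"
    using assms(2) by (auto simp: space_uniform_count_measure)
  finally show "emeasure Q A = 0" by simp
qed

lemma divergence_ballD:
  assumes "P \<in> divergence_ball f Q r"
  shows "prob_space P" "sets P = sets N" "absolutely_continuous Q P" "f_divergence f P Q \<le> ereal r"
  using assms by (auto simp: divergence_ball_def)

text \<open>Under the empirical measure any measurable function is almost everywhere bounded by the
  sum of its absolute values at the observations, and absolute continuity carries this bound over to
  \<open>P\<close>.\<close>

lemma integrable_divergence_ball:
  fixes h :: "'a \<Rightarrow> real"
  assumes P: "P \<in> divergence_ball f Q r" and h: "h \<in> borel_measurable N"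
  shows "integrable P h"
proof -
  interpret P: prob_space P by (rule divergence_ballD[OF P])
  have hP: "h \<in> borel_measurable P"
    using h measurable_cong_sets[OF divergence_ballD(2)[OF P] refl] by blast
  note h[measurable]
  have "AE s in Q. \<bar>h s\<bar> \<le> (\<Sum>i<n. \<bar>h (X i \<omega>)\<bar>)"
  proof (rule AE_Q)
    show "{s\<in>space N. \<not> \<bar>h s\<bar> \<le> (\<Sum>i<n. \<bar>h (X i \<omega>)\<bar>)} \<in> sets N" by measurable
    fix i assume "i < n"
    then have "\<bar>h (X i \<omega>)\<bar> \<le> (\<Sum>i<n. \<bar>h (X i \<omega>)\<bar>)"
      by (intro member_le_sum) auto
    then show "X i \<omega> \<notin> {s\<in>space N. \<not> \<bar>h s\<bar> \<le> (\<Sum>i<n. \<bar>h (X i \<omega>)\<bar>)}" by simp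
  qed auto
  then have "AE s in P. \<bar>h s\<bar> \<le> (\<Sum>i<n. \<bar>h (X i \<omega>)\<bar>)"
    by (rule absolutely_continuous_AE[rotated 2]) (use divergence_ballD[OF P] in auto)
  then show ?thesis
    by (intro P.integrable_const_bound[OF _ hP]) auto
qed

text \<open>This makes the empirical mean a lower bound for the worst-case risk.\<close>

lemma center_in_divergence_ball:
  assumes "f 1 = 0" "r \<ge> 0"
  shows "Q \<in> divergence_ball f Q r"
proof -
  interpret Q: prob_space Q by (rule prob_space_Q)
  have "density Q (\<lambda>_. 1) = Q" by (rule density_1)
  from Q.RN_deriv_unique[OF _ this] have one: "AE s in Q. RN_deriv Q Q s = 1"
    by auto
  have "(\<integral>\<^sup>+s. e2ennreal (f (enn2real (RN_deriv Q Q s))) \<partial>Q) = (\<integral>\<^sup>+s. 0 \<partial>Q)"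
    by (rule nn_integral_cong_AE) (use one assms(1) in auto)
  moreover have "(\<integral>\<^sup>+s. e2ennreal (- f (enn2real (RN_deriv Q Q s))) \<partial>Q) = (\<integral>\<^sup>+s. 0 \<partial>Q)"
    by (rule nn_integral_cong_AE) (use one assms(1) in auto)
  ultimately have "f_divergence f Q Q = 0"
    unfolding f_divergence_def by (simp add: zero_ennreal.rep_eq)
  then show ?thesis
    using prob_space_Q assms(2) by (auto simp: divergence_ball_def absolutely_continuous_def)
qed

text \<open>The weight \<open>1/n\<close> of an observation cancels against the radius
  \<open>\<rho>/n\<close>, which leaves a bound independent of \<open>n\<close>.\<close>

lemma sum_likelihood_ratio_le:
  assumes c: "c > 0" "\<And>t. t \<ge> 0 \<Longrightarrow> ereal (c * min \<bar>t - 1\<bar> ((t - 1)\<^sup>2)) \<le> f t"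
    and \<rho>: "\<rho> \<ge> 0" and P: "P \<in> divergence_ball f Q (\<rho> / real n)"
  defines "L \<equiv> \<lambda>i. enn2real (RN_deriv Q P (X i \<omega>))"
  shows "(\<Sum>i<n. min \<bar>L i - 1\<bar> ((L i - 1)\<^sup>2)) \<le> \<rho> / c"
proof -
  define \<phi> where "\<phi> t = min \<bar>t - 1\<bar> ((t - 1)\<^sup>2)" for t :: real
  have \<phi>0: "\<phi> t \<ge> 0" for t by (simp add: \<phi>_def)
  define \<Lambda> where "\<Lambda> s = enn2real (RN_deriv Q P s)" for s
  have \<Lambda>[measurable]: "\<Lambda> \<in> borel_measurable N"
  proof -
    have "RN_deriv Q P \<in> borel_measurable N"
      using borel_measurable_RN_deriv[of Q P] measurable_cong_sets[OF sets_Q refl] by blast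
    then show ?thesis unfolding \<Lambda>_def[abs_def] by measurable
  qed
  have f\<phi>: "ereal (c * \<phi> (\<Lambda> s)) \<le> f (\<Lambda> s)" for s
    unfolding \<phi>_def by (rule c(2)) (simp add: \<Lambda>_def)
  have f0: "0 \<le> f (\<Lambda> s)" for s
    using f\<phi>[of s] c(1) \<phi>0[of "\<Lambda> s"] by (metis ereal_less_eq(5) mult_nonneg_nonneg less_imp_le order_trans)
  have "(\<Sum>i<n. ennreal (1 / real n) * ennreal (c * \<phi> (L i))) = (\<integral>\<^sup>+s. ennreal (c * \<phi> (\<Lambda> s)) \<partial>Q)"
    by (subst nn_integral_Q) (auto simp: L_def \<Lambda>_def[symmetric] \<phi>_def[abs_def])
  also have "\<dots> \<le> (\<integral>\<^sup>+s. e2ennreal (f (\<Lambda> s)) \<partial>Q)"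
    using e2ennreal_mono[OF f\<phi>] by (intro nn_integral_mono) (simp add: ennreal.abs_eq)
  also have "\<dots> \<le> ennreal (\<rho> / real n)"
  proof -
    \<comment> \<open>\<open>f\<close> is nonnegative at the likelihood ratios, so the subtracted
      integral in \<open>f_divergence\<close> vanishes.\<close>
    have neg: "(\<integral>\<^sup>+s. e2ennreal (- f (\<Lambda> s)) \<partial>Q) = 0"
      using f0 by (simp add: e2ennreal_neg ereal_uminus_le_reorder)
    have "enn2ereal (\<integral>\<^sup>+s. e2ennreal (f (\<Lambda> s)) \<partial>Q) \<le> ereal (\<rho> / real n)"
      using divergence_ballD(4)[OF P] unfolding f_divergence_def \<Lambda>_def[symmetric] neg
      by (simp add: zero_ennreal.rep_eq)
    from e2ennreal_mono[OF this] show ?thesis by simp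
  qed
  also have "(\<Sum>i<n. ennreal (1 / real n) * ennreal (c * \<phi> (L i))) = ennreal (\<Sum>i<n. 1 / real n * (c * \<phi> (L i)))"
    using c(1) \<phi>0 by (subst sum_ennreal[symmetric]) (auto simp: ennreal_mult[symmetric])
  finally have "(\<Sum>i<n. 1 / real n * (c * \<phi> (L i))) \<le> \<rho> / real n"
    using \<rho> by (simp add: ennreal_le_iff)
  moreover have "(\<Sum>i<n. 1 / real n * (c * \<phi> (L i))) = c * (\<Sum>i<n. \<phi> (L i)) / real n"
    by (simp add: sum_distrib_left sum_divide_distrib)
  ultimately have "c * (\<Sum>i<n. \<phi> (L i)) \<le> \<rho>"
    using n_pos by (simp add: divide_le_cancel)
  then show ?thesis using c(1) by (simp add: \<phi>_def field_simps)
qed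

text \<open>The difference of the means is the average of
  \<open>(L i - 1) * h (X i \<omega>)\<close>. Where \<open>h\<close> is at most \<open>K\<close> in
  absolute value, the mean of \<open>\<bar>L i - 1\<bar>\<close> is used, which is of order
  \<open>1 / sqrt n\<close>; on the tail the uniform bound \<open>B\<close> on
  \<open>\<bar>L i - 1\<bar>\<close> is used.\<close>

lemma integral_divergence_ball_deviation:
  assumes c: "c > 0" "\<And>t. t \<ge> 0 \<Longrightarrow> ereal (c * min \<bar>t - 1\<bar> ((t - 1)\<^sup>2)) \<le> f t"
    and \<rho>: "\<rho> \<ge> 0" and P: "P \<in> divergence_ball f Q (\<rho> / real n)"
    and h: "h \<in> borel_measurable N" and K: "K \<ge> 0"
  defines "B \<equiv> max 1 (\<rho> / c)"
  shows "\<bar>(\<integral>s. h s \<partial>P) - (\<Sum>i<n. h (X i \<omega>)) / real n\<bar>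
    \<le> K * sqrt (B * (\<rho> / c) / real n)
      + B * ((\<Sum>i<n. if K < \<bar>h (X i \<omega>)\<bar> then \<bar>h (X i \<omega>)\<bar> else 0) / real n)"
proof -
  interpret P: prob_space P by (rule divergence_ballD[OF P])
  interpret Q: prob_space Q by (rule prob_space_Q)
  define L where "L i = enn2real (RN_deriv Q P (X i \<omega>))" for i
  define \<phi> where "\<phi> t = min \<bar>t - 1\<bar> ((t - 1)\<^sup>2)" for t :: real
  have sum\<phi>: "(\<Sum>i<n. \<phi> (L i)) \<le> \<rho> / c"
    unfolding \<phi>_def L_def by (rule sum_likelihood_ratio_le[OF c \<rho> P])
  have B: "B \<ge> 1" "\<rho> / c \<le> B" by (auto simp: B_def)
  \<comment> \<open>Each observation has mass at least \<open>1/n\<close>, so a divergence of order \<open>1/n\<close> bounds every ratio \<open>L i\<close>.\<close>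
  have LB: "\<bar>L i - 1\<bar> \<le> B" if "i < n" for i
  proof -
    have "\<phi> (L i) \<le> (\<Sum>i<n. \<phi> (L i))" using that by (intro member_le_sum) (auto simp: \<phi>_def)
    then have *: "\<phi> (L i) \<le> B" using sum\<phi> B by linarith
    show ?thesis
    proof (cases "\<bar>L i - 1\<bar> \<le> 1")
      case False
      then have "\<bar>L i - 1\<bar> * 1 \<le> \<bar>L i - 1\<bar> * \<bar>L i - 1\<bar>" by (intro mult_left_mono) auto
      then have "\<phi> (L i) = \<bar>L i - 1\<bar>" by (simp add: \<phi>_def power2_eq_square)
      then show ?thesis using * by simp
    qed (use B in simp)
  qed
  \<comment> \<open>In the linear branch of \<open>\<phi>\<close> one factor is bounded by
    \<open>B\<close>; in the quadratic branch \<open>B \<ge> 1\<close> suffices.\<close>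
  have sq: "(L i - 1)\<^sup>2 \<le> B * \<phi> (L i)" if "i < n" for i
  proof -
    have "\<bar>L i - 1\<bar> * \<bar>L i - 1\<bar> \<le> B * \<bar>L i - 1\<bar>" using LB[OF that] by (intro mult_right_mono) auto
    moreover have "1 * (L i - 1)\<^sup>2 \<le> B * (L i - 1)\<^sup>2" using B by (intro mult_right_mono) auto
    ultimately show ?thesis by (simp add: \<phi>_def min_def power2_eq_square)
  qed
  have "(\<Sum>i<n. (L i - 1)\<^sup>2) \<le> (\<Sum>i<n. B * \<phi> (L i))" using sq by (intro sum_mono) auto
  also have "\<dots> \<le> B * (\<rho> / c)"
    unfolding sum_distrib_left[symmetric] using sum\<phi> B by (intro mult_left_mono) auto
  finally have sumsq: "(\<Sum>i<n. (L i - 1)\<^sup>2) \<le> B * (\<rho> / c)" .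
  \<comment> \<open>The Cauchy-Schwarz inequality turns the bounded sum of squares into a mean
    absolute deviation of order \<open>1 / sqrt n\<close>.\<close>
  have "(\<Sum>i<n. \<bar>L i - 1\<bar>)\<^sup>2 \<le> (\<Sum>i<n. \<bar>L i - 1\<bar>\<^sup>2) * real (card {..<n})"
    by (rule sum_squared_le_sum_of_squares)
  also have "\<dots> \<le> B * (\<rho> / c) * real n" using mult_right_mono[OF sumsq, of "real n"] by simp
  finally have "((\<Sum>i<n. \<bar>L i - 1\<bar>) / real n)\<^sup>2 \<le> B * (\<rho> / c) * real n / (real n)\<^sup>2"
    unfolding power_divide by (rule divide_right_mono) simp
  also have "\<dots> = B * (\<rho> / c) / real n" by (simp add: power2_eq_square)
  finally have L1: "(\<Sum>i<n. \<bar>L i - 1\<bar>) / real n \<le> sqrt (B * (\<rho> / c) / real n)"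
    by (rule real_le_rsqrt)
  have hQ: "h \<in> borel_measurable Q" using h measurable_cong_sets[OF sets_Q refl] by blast
  have "(\<integral>s. h s \<partial>P) = (\<integral>s. enn2real (RN_deriv Q P s) * h s \<partial>Q)"
    using divergence_ballD[OF P] by (intro Q.RN_deriv_integral hQ P.sigma_finite_measure_axioms) auto
  also have "\<dots> = (\<Sum>i<n. L i * h (X i \<omega>)) / real n"
  proof (subst integral_Q)
    have "RN_deriv Q P \<in> borel_measurable N"
      using borel_measurable_RN_deriv[of Q P] measurable_cong_sets[OF sets_Q refl] by blast
    then show "(\<lambda>s. enn2real (RN_deriv Q P s) * h s) \<in> borel_measurable N" using h by measurable
  qed (simp add: L_def)
  finally have "(\<integral>s. h s \<partial>P) - (\<Sum>i<n. h (X i \<omega>)) / real n = (\<Sum>i<n. (L i - 1) * h (X i \<omega>)) / real n"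
    by (simp add: sum_subtractf left_diff_distrib diff_divide_distrib)
  then have "\<bar>(\<integral>s. h s \<partial>P) - (\<Sum>i<n. h (X i \<omega>)) / real n\<bar> = \<bar>\<Sum>i<n. (L i - 1) * h (X i \<omega>)\<bar> / real n"
    by simp
  also have "\<dots> \<le> (\<Sum>i<n. K * \<bar>L i - 1\<bar> + B * (if K < \<bar>h (X i \<omega>)\<bar> then \<bar>h (X i \<omega>)\<bar> else 0)) / real n"
  proof (intro divide_right_mono order_trans[OF sum_abs] sum_mono)
    fix i assume "i \<in> {..<n}"
    then have i: "i < n" by simp
    have "\<bar>L i - 1\<bar> * \<bar>h (X i \<omega>)\<bar> \<le> B * \<bar>h (X i \<omega>)\<bar>" using LB[OF i] by (intro mult_right_mono) auto
    moreover have "K * \<bar>L i - 1\<bar> \<ge> 0" using K by simp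
    moreover have "\<bar>h (X i \<omega>)\<bar> \<le> K \<Longrightarrow> \<bar>L i - 1\<bar> * \<bar>h (X i \<omega>)\<bar> \<le> \<bar>L i - 1\<bar> * K"
      by (intro mult_left_mono) auto
    ultimately show "\<bar>(L i - 1) * h (X i \<omega>)\<bar> \<le> K * \<bar>L i - 1\<bar> + B * (if K < \<bar>h (X i \<omega>)\<bar> then \<bar>h (X i \<omega>)\<bar> else 0)"
      unfolding abs_mult by (auto simp: mult.commute)
  qed simp
  also have "\<dots> = K * ((\<Sum>i<n. \<bar>L i - 1\<bar>) / real n)
      + B * ((\<Sum>i<n. if K < \<bar>h (X i \<omega>)\<bar> then \<bar>h (X i \<omega>)\<bar> else 0) / real n)"
    by (simp add: sum.distrib sum_distrib_left add_divide_distrib)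
  also have "\<dots> \<le> K * sqrt (B * (\<rho> / c) / real n)
      + B * ((\<Sum>i<n. if K < \<bar>h (X i \<omega>)\<bar> then \<bar>h (X i \<omega>)\<bar> else 0) / real n)"
    using L1 K by (intro add_right_mono mult_left_mono) auto
  finally show ?thesis .
qed

text \<open>The previous bound is uniform over the ball, and the center gives the other side.
  Finiteness is recorded because \<open>real_of_ereal\<close> would send infinite values to
  0.\<close>

lemma worst_case_risk_deviation:
  assumes c: "c > 0" "\<And>t. t \<ge> 0 \<Longrightarrow> ereal (c * min \<bar>t - 1\<bar> ((t - 1)\<^sup>2)) \<le> f t"
    and f1: "f 1 = 0" and \<rho>: "\<rho> \<ge> 0"
    and h: "h \<in> borel_measurable N" and K: "K \<ge> 0"
  defines "B \<equiv> max 1 (\<rho> / c)"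
  shows "\<bar>worst_case_risk f (\<rho> / real n) Q h\<bar> \<noteq> \<infinity>"
    "\<bar>real_of_ereal (worst_case_risk f (\<rho> / real n) Q h) - (\<Sum>i<n. h (X i \<omega>)) / real n\<bar>
      \<le> K * sqrt (B * (\<rho> / c) / real n)
        + B * ((\<Sum>i<n. if K < \<bar>h (X i \<omega>)\<bar> then \<bar>h (X i \<omega>)\<bar> else 0) / real n)" (is "_ \<le> ?b")
proof -
  let ?m = "(\<Sum>i<n. h (X i \<omega>)) / real n"
  have "ereal (\<integral>s. h s \<partial>Q) \<le> worst_case_risk f (\<rho> / real n) Q h"
    unfolding worst_case_risk_def using \<rho> n_pos
    by (intro SUP_upper center_in_divergence_ball f1) auto
  then have lower: "ereal ?m \<le> worst_case_risk f (\<rho> / real n) Q h"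
    by (simp add: integral_Q[OF h])
  have upper: "worst_case_risk f (\<rho> / real n) Q h \<le> ereal (?m + ?b)"
    unfolding worst_case_risk_def
  proof (rule SUP_least)
    fix P assume "P \<in> divergence_ball f Q (\<rho> / real n)"
    from integral_divergence_ball_deviation[OF c \<rho> this h K]
    show "ereal (\<integral>s. h s \<partial>P) \<le> ereal (?m + ?b)" unfolding B_def by simp
  qed
  show fin: "\<bar>worst_case_risk f (\<rho> / real n) Q h\<bar> \<noteq> \<infinity>"
    using lower upper by auto
  then obtain w where w: "worst_case_risk f (\<rho> / real n) Q h = ereal w" by auto
  have "?m \<le> w" "w \<le> ?m + ?b" using lower upper unfolding w by auto
  then show "\<bar>real_of_ereal (worst_case_risk f (\<rho> / real n) Q h) - ?m\<bar> \<le> ?b" unfolding w by simp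
qed

text \<open>A supremum of convex functions is convex: absolute continuity makes the loss convex
  almost everywhere under each \<open>P\<close> in the ball, hence its \<open>P\<close>-mean is
  convex.\<close>

lemma convex_on_worst_case_risk:
  fixes C :: "'c::real_vector set"
  assumes C: "convex C" and l: "\<And>x. x \<in> C \<Longrightarrow> l x \<in> borel_measurable N"
    and conv: "AE s in Q. convex_on C (\<lambda>x. l x s)"
    and fin: "\<And>x. x \<in> C \<Longrightarrow> \<bar>worst_case_risk f r Q (l x)\<bar> \<noteq> \<infinity>"
  shows "convex_on C (\<lambda>x. real_of_ereal (worst_case_risk f r Q (l x)))"
  unfolding convex_on_def
proof (intro conjI ballI allI impI C)
  fix x y and u v :: real
  assume x: "x \<in> C" and y: "y \<in> C" and uv: "0 \<le> u" "0 \<le> v" "u + v = 1"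
  define G where "G x = real_of_ereal (worst_case_risk f r Q (l x))" for x
  have G: "worst_case_risk f r Q (l x) = ereal (G x)" if "x \<in> C" for x
    using fin[OF that] by (simp add: G_def ereal_real')
  have z: "u *\<^sub>R x + v *\<^sub>R y \<in> C" using C x y uv by (rule convexD)
  have le: "(\<integral>s. l x s \<partial>P) \<le> G x" if "P \<in> divergence_ball f Q r" "x \<in> C" for P x
  proof -
    have "ereal (\<integral>s. l x s \<partial>P) \<le> worst_case_risk f r Q (l x)"
      unfolding worst_case_risk_def using that(1) by (rule SUP_upper)
    then show ?thesis using G[OF that(2)] by simp
  qed
  have "worst_case_risk f r Q (l (u *\<^sub>R x + v *\<^sub>R y)) \<le> ereal (u * G x + v * G y)"
    unfolding worst_case_risk_def
  proof (rule SUP_least)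
    fix P assume P: "P \<in> divergence_ball f Q r"
    note int = integrable_divergence_ball[OF P l]
    have "AE s in P. convex_on C (\<lambda>x. l x s)"
      by (rule absolutely_continuous_AE[OF _ _ conv]) (use divergence_ballD[OF P] in auto)
    then have "AE s in P. l (u *\<^sub>R x + v *\<^sub>R y) s \<le> u * l x s + v * l y s"
      by eventually_elim (use x y uv in \<open>auto simp: convex_on_def\<close>)
    then have "(\<integral>s. l (u *\<^sub>R x + v *\<^sub>R y) s \<partial>P) \<le> (\<integral>s. u * l x s + v * l y s \<partial>P)"
      using int x y z by (intro integral_mono_AE) auto
    also have "\<dots> = u * (\<integral>s. l x s \<partial>P) + v * (\<integral>s. l y s \<partial>P)" using int x y by simp
    also have "\<dots> \<le> u * G x + v * G y" using le[OF P] x y uv by (intro add_mono mult_left_mono) auto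
    finally show "ereal (\<integral>s. l (u *\<^sub>R x + v *\<^sub>R y) s \<partial>P) \<le> ereal (u * G x + v * G y)" by simp
  qed
  then show "real_of_ereal (worst_case_risk f r Q (l (u *\<^sub>R x + v *\<^sub>R y)))
      \<le> u * real_of_ereal (worst_case_risk f r Q (l x)) + v * real_of_ereal (worst_case_risk f r Q (l y))"
    unfolding G_def[symmetric] G[OF z] by simp
qed

end

section \<open>Lower semicontinuity and minimizers\<close>

text \<open>The sublevel sets at the values of \<open>F\<close> form a chain of nonempty compact
  sets; any common point is a minimizer.\<close>

lemma exists_minimizer_of_compact_sublevels:
  fixes F :: "'a::heine_borel \<Rightarrow> real"
  assumes "X \<noteq> {}" and compact: "\<And>a. compact {x\<in>X. F x \<le> a}"
  obtains x where "x \<in> X" "\<And>z. z \<in> X \<Longrightarrow> F x \<le> F z"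
proof -
  have "\<Inter>((\<lambda>z. {x\<in>X. F x \<le> F z}) ` X) \<noteq> {}"
    by (rule compact_chain) (use compact in fastforce)+
  then obtain x where "\<And>z. z \<in> X \<Longrightarrow> x \<in> {x\<in>X. F x \<le> F z}" by blast
  then show thesis using that[of x] assms(1) by blast
qed

text \<open>If there were no gap, the near-minimizers at distance at least \<open>\<eta>\<close>
  from \<open>S\<close> would form decreasing nonempty compact sets, and a common point would lie in
  \<open>S\<close> while being far from it.\<close>

lemma minimizers_well_separated:
  fixes F :: "'a::heine_borel \<Rightarrow> real"
  assumes compact: "\<And>a. compact {x\<in>X. F x \<le> a}" and \<eta>: "\<eta> > 0"
    and S: "S = {x\<in>X. F x \<le> v}" "S \<noteq> {}"
  shows "\<exists>\<gamma>>0. \<forall>x\<in>X. \<eta> \<le> infdist x S \<longrightarrow> v + \<gamma> \<le> F x"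
proof (rule ccontr)
  assume contra: "\<not> ?thesis"
  define T where "T n = {x\<in>X. F x \<le> v + 1 / real (Suc n)} \<inter> {x. \<eta> \<le> infdist x S}" for n
  have "\<Inter>(range T) \<noteq> {}"
  proof (rule compact_nest)
    show "compact (T n)" for n
      unfolding T_def by (intro compact_Int_closed compact closed_Collect_le continuous_intros)
    show "T n \<noteq> {}" for n
    proof -
      have "\<not> (\<forall>x\<in>X. \<eta> \<le> infdist x S \<longrightarrow> v + 1 / real (Suc n) \<le> F x)"
        using contra by (metis of_nat_0_less_iff zero_less_Suc zero_less_divide_1_iff)
      then show ?thesis unfolding T_def by fastforce
    qed
    fix m n :: nat assume "m \<le> n"
    then have "1 / real (Suc n) \<le> 1 / real (Suc m)" by (simp add: frac_le)
    then show "T n \<subseteq> T m" by (auto simp: T_def)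
  qed
  then obtain x where x: "\<And>n. x \<in> T n" by blast
  have "F x \<le> v"
  proof (rule field_le_epsilon)
    fix e :: real assume "e > 0"
    then obtain n where "1 / real (Suc n) < e" using nat_approx_posE by blast
    moreover have "F x \<le> v + 1 / real (Suc n)" using x[of n] by (auto simp: T_def)
    ultimately show "F x \<le> v + e" by linarith
  qed
  then have "x \<in> S" using x[of 0] S by (auto simp: T_def)
  then have "infdist x S = 0" by simp
  moreover have "\<eta> \<le> infdist x S" using x[of 0] by (auto simp: T_def)
  ultimately show False using \<eta> by simp
qed

text \<open>Fatou's lemma for \<open>l (ys n) s - g s\<close>, which is nonnegative once the
  sequence has entered the neighborhood \<open>U\<close>; passing to \<open>ys\<close> drops the
  initial terms.\<close>

lemma integral_le_of_lsc_sequence: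
  fixes l :: "'a::metric_space \<Rightarrow> 'b \<Rightarrow> real"
  assumes int: "\<And>x. x \<in> X \<Longrightarrow> integrable N (l x)"
    and lsc: "AE s in N. lsc_on X (\<lambda>x. ereal (l x s))"
    and g: "integrable N g" "open U" "x \<in> U" "\<And>z s. z \<in> U \<Longrightarrow> z \<in> X \<Longrightarrow> s \<in> space N \<Longrightarrow> g s \<le> l z s"
    and xs: "\<And>n. xs n \<in> X" "xs \<longlonglongrightarrow> x" and x: "x \<in> X"
    and le: "\<And>n. (\<integral>s. l (xs n) s \<partial>N) \<le> a"
  shows "(\<integral>s. l x s \<partial>N) \<le> a"
proof -
  have "\<forall>\<^sub>F n in sequentially. xs n \<in> U" using xs(2) g(2,3) by (rule topological_tendstoD)
  then obtain n0 where n0: "\<And>n. n \<ge> n0 \<Longrightarrow> xs n \<in> U" by (auto simp: eventually_sequentially)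
  define ys where "ys n = xs (n + n0)" for n
  have ys: "ys n \<in> X" "ys n \<in> U" for n using xs(1) n0 by (auto simp: ys_def)
  have ys_lim: "ys \<longlonglongrightarrow> x" unfolding ys_def[abs_def] using xs(2) by (rule LIMSEQ_ignore_initial_segment)
  have eq: "(\<integral>\<^sup>+s. ennreal (l z s - g s) \<partial>N) = ennreal ((\<integral>s. l z s \<partial>N) - (\<integral>s. g s \<partial>N))" if "z \<in> X" "z \<in> U" for z
  proof -
    have "(\<integral>\<^sup>+s. ennreal (l z s - g s) \<partial>N) = ennreal (\<integral>s. l z s - g s \<partial>N)"
      using int[OF that(1)] g(1,4) that by (intro nn_integral_eq_integral) auto
    then show ?thesis using int[OF that(1)] g(1) by simp
  qed
  have "AE s in N. ennreal (l x s - g s) \<le> liminf (\<lambda>n. ennreal (l (ys n) s - g s))"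
    using lsc
  proof eventually_elim
    fix s assume s: "lsc_on X (\<lambda>x. ereal (l x s))"
    show "ennreal (l x s - g s) \<le> liminf (\<lambda>n. ennreal (l (ys n) s - g s))"
      unfolding le_Liminf_iff
    proof (intro allI impI)
      fix y :: ennreal assume y: "y < ennreal (l x s - g s)"
      then obtain r where r: "r \<ge> 0" "y = ennreal r" by (cases y) auto
      then have rl: "r < l x s - g s" using y by (simp add: ennreal_less_iff)
      have "ereal (l x s) \<le> Liminf (at x within X) (\<lambda>x. ereal (l x s))"
        using s x by (auto simp: lsc_on_def)
      then have "\<forall>\<^sub>F z in at x within X. ereal (r + g s) < ereal (l z s)"
        unfolding le_Liminf_iff using rl by (elim allE[of _ "ereal (r + g s)"]) simp
      \<comment> \<open>The filter \<open>at x within X\<close> omits \<open>x\<close> itself; there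
        the inequality is \<open>rl\<close>.\<close>
      then have "\<forall>\<^sub>F z in nhds x. z \<in> X \<longrightarrow> r + g s < l z s"
        unfolding eventually_at_filter by eventually_elim (use rl in auto)
      then have "\<forall>\<^sub>F n in sequentially. ys n \<in> X \<longrightarrow> r + g s < l (ys n) s"
        using ys_lim by (rule eventually_compose_filterlim)
      then show "\<forall>\<^sub>F n in sequentially. y < ennreal (l (ys n) s - g s)"
        by eventually_elim (use ys r in \<open>auto simp: ennreal_less_iff\<close>)
    qed
  qed
  then have "(\<integral>\<^sup>+s. ennreal (l x s - g s) \<partial>N) \<le> (\<integral>\<^sup>+s. liminf (\<lambda>n. ennreal (l (ys n) s - g s)) \<partial>N)"
    by (rule nn_integral_mono_AE)
  also have "\<dots> \<le> liminf (\<lambda>n. \<integral>\<^sup>+s. ennreal (l (ys n) s - g s) \<partial>N)"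
    using borel_measurable_integrable[OF int[OF ys(1)]] borel_measurable_integrable[OF g(1)]
    by (intro nn_integral_liminf) measurable
  also have "\<dots> \<le> liminf (\<lambda>n. ennreal (a - (\<integral>s. g s \<partial>N)))"
    by (intro Liminf_mono always_eventually allI) (simp add: eq ys, intro ennreal_leI, use le in \<open>simp add: ys_def\<close>)
  also have "\<dots> = ennreal (a - (\<integral>s. g s \<partial>N))" by (simp add: Liminf_const)
  finally have "ennreal ((\<integral>s. l x s \<partial>N) - (\<integral>s. g s \<partial>N)) \<le> ennreal (a - (\<integral>s. g s \<partial>N))"
    using eq[OF x g(3)] by simp
  \<comment> \<open>\<open>ennreal\<close> sends negative numbers to 0, so the comparison of
    integrals returns to the reals only once \<open>a\<close> is known to dominate the integral of
    \<open>g\<close>.\<close>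
  moreover have "(\<integral>s. g s \<partial>N) \<le> (\<integral>s. l z s \<partial>N)" if "z \<in> X" "z \<in> U" for z
    using int g that by (intro integral_mono) auto
  from this[OF ys[of 0]] have "(\<integral>s. g s \<partial>N) \<le> a" using le[of n0] by (simp add: ys_def)
  ultimately show ?thesis by (simp add: ennreal_le_iff)
qed

lemma compact_sublevels_of_coercive:
  fixes F :: "'a::euclidean_space \<Rightarrow> real"
  assumes closed: "closed {x\<in>X. F x \<le> a}"
    and coercive: "compact X \<or> filterlim F at_top (inf at_infinity (principal X))"
  shows "compact {x\<in>X. F x \<le> a}"
  using coercive
proof
  assume "compact X"
  from compact_Int_closed[OF this closed] show ?thesis by (simp add: Int_def conj_left_commute cong: conj_cong)
next
  assume "filterlim F at_top (inf at_infinity (principal X))"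
  then have "\<forall>\<^sub>F x in at_infinity. x \<in> X \<longrightarrow> a < F x"
    unfolding filterlim_at_top_dense eventually_inf_principal by blast
  then obtain b where b: "\<And>x. b \<le> norm x \<Longrightarrow> x \<in> X \<Longrightarrow> a < F x"
    unfolding eventually_at_infinity by blast
  have "norm x \<le> b" if "x \<in> X" "F x \<le> a" for x using b[of x] that by force
  then have "bounded {x\<in>X. F x \<le> a}" by (intro boundedI[of _ b]) auto
  then show ?thesis using closed by (simp add: compact_eq_bounded_closed)
qed

section \<open>Convergence in outer probability through exceptional events\<close>

text \<open>The bad outcomes, possibly not measurable, are enclosed in measurable events of
  vanishing probability.\<close>

lemma tendsto_outer_probI:
  assumes "finite_measure M"
    and "\<And>\<eta>. \<eta> > 0 \<Longrightarrow> \<exists>E. (\<forall>n. E n \<in> sets M) \<and> (\<lambda>n. measure M (E n)) \<longlonglongrightarrow> 0 \<and>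
      (\<forall>\<^sub>F n in sequentially. \<forall>\<omega>\<in>space M - E n. \<bar>Y n \<omega> - c\<bar> \<le> ereal \<eta>)"
  shows "tendsto_outer_prob M Y c"
  unfolding tendsto_outer_prob_def
proof (intro allI impI)
  fix \<eta> :: real assume "\<eta> > 0"
  then obtain E where E: "\<And>n. E n \<in> sets M" "(\<lambda>n. measure M (E n)) \<longlonglongrightarrow> 0"
    and good: "\<forall>\<^sub>F n in sequentially. \<forall>\<omega>\<in>space M - E n. \<bar>Y n \<omega> - c\<bar> \<le> ereal \<eta>"
    using assms(2)[OF \<open>\<eta> > 0\<close>] by blast
  have lim: "(\<lambda>n. emeasure M (E n)) \<longlonglongrightarrow> 0"
    using E(2) by (simp add: finite_measure.emeasure_eq_measure[OF assms(1)] flip: ennreal_0)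
  have le: "\<forall>\<^sub>F n in sequentially. outer_measure_of M {\<omega>\<in>space M. ereal \<eta> < \<bar>Y n \<omega> - c\<bar>} \<le> emeasure M (E n)"
    using good
  proof eventually_elim
    case (elim n)
    then have "{\<omega>\<in>space M. ereal \<eta> < \<bar>Y n \<omega> - c\<bar>} \<subseteq> E n" by (auto simp: not_le[symmetric])
    from outer_measure_of_mono[OF this, of M] show ?case using E(1)[of n] by simp
  qed
  have nonneg: "\<forall>\<^sub>F n in sequentially. 0 \<le> outer_measure_of M {\<omega>\<in>space M. ereal \<eta> < \<bar>Y n \<omega> - c\<bar>}"
    by simp
  show "(\<lambda>n. outer_measure_of M {\<omega>\<in>space M. ereal \<eta> < \<bar>Y n \<omega> - c\<bar>}) \<longlonglongrightarrow> 0"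
    by (rule tendsto_sandwich[OF nonneg le tendsto_const lim])
qed

context prob_space
begin

text \<open>The truncation level \<open>K\<close> is fixed first, then \<open>n\<close> is taken
  large enough to absorb the term of order \<open>K / sqrt n\<close>. The exceptional events involve
  only sample averages of \<open>h\<close> and of its tail, so measurability of the worst-case risk
  is not an issue.\<close>

lemma worst_case_risk_consistent:
  fixes h :: "'b \<Rightarrow> real"
  assumes indep: "indep_vars (\<lambda>_. N) \<xi> (UNIV::nat set)" and distr: "\<And>i. distr M N (\<xi> i) = N"
    and h: "integrable N h" and f: "smooth_divergence_function f" and \<rho>: "\<rho> \<ge> 0" and \<delta>: "\<delta> > 0"
  shows "\<exists>E. (\<forall>n. E n \<in> events) \<and> (\<lambda>n. prob (E n)) \<longlonglongrightarrow> 0 \<and>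
    (\<forall>\<^sub>F n in sequentially. \<forall>\<omega>\<in>space M - E n.
      \<bar>real_of_ereal (worst_case_risk f (\<rho> / real n) (empirical_measure N \<xi> n \<omega>) h) - (\<integral>s. h s \<partial>N)\<bar> \<le> \<delta>)"
proof -
  have \<xi>[measurable]: "\<xi> i \<in> measurable M N" for i
    using indep unfolding indep_vars_def2 by simp
  note hm[measurable] = borel_measurable_integrable[OF h]
  obtain c where c: "c > 0" "\<And>t. t \<ge> 0 \<Longrightarrow> ereal (c * min \<bar>t - 1\<bar> ((t - 1)\<^sup>2)) \<le> f t"
    using smooth_divergence_function_lower_bound[OF f] by metis
  have f1: "f 1 = 0" using f by (simp add: smooth_divergence_function_def)
  define B where "B = max 1 (\<rho> / c)"
  have B: "B \<ge> 1" by (simp add: B_def)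
  \<comment> \<open>The tail mean and its sampling error each stay below
    \<open>\<delta> / (4 * B)\<close>; after multiplication by \<open>B\<close> they cost
    \<open>\<delta>/2\<close>, leaving \<open>\<delta>/4\<close> for each of the two other
    errors.\<close>
  obtain K :: nat where K: "\<bar>\<integral>s. (if real K < \<bar>h s\<bar> then \<bar>h s\<bar> else 0) \<partial>N\<bar> < \<delta> / (4 * B)"
    using LIMSEQ_D[OF integral_tail_tendsto_0[OF h], of "\<delta> / (4 * B)"] \<delta> B by fastforce
  define k where "k s = (if real K < \<bar>h s\<bar> then \<bar>h s\<bar> else 0)" for s
  have km[measurable]: "k \<in> borel_measurable N" unfolding k_def[abs_def] by measurable
  have k: "integrable N k"
    by (rule Bochner_Integration.integrable_bound[OF h]) (auto simp: k_def)
  define E1 where "E1 n = {\<omega>\<in>space M. \<delta>/4 \<le> \<bar>(\<Sum>i<n. h (\<xi> i \<omega>)) / real n - (\<integral>s. h s \<partial>N)\<bar>}" for n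
  define E2 where "E2 n = {\<omega>\<in>space M. \<delta>/(4*B) \<le> \<bar>(\<Sum>i<n. k (\<xi> i \<omega>)) / real n - (\<integral>s. k s \<partial>N)\<bar>}" for n
  have E: "E1 n \<in> events" "E2 n \<in> events" for n by (auto simp: E1_def E2_def)
  have lims: "(\<lambda>n. prob (E1 n)) \<longlonglongrightarrow> 0" "(\<lambda>n. prob (E2 n)) \<longlonglongrightarrow> 0"
    unfolding E1_def E2_def
    by (rule weak_law_of_large_numbers[OF indep distr]; use \<delta> B h k in simp)+
  have lim: "(\<lambda>n. prob (E1 n \<union> E2 n)) \<longlonglongrightarrow> 0"
  proof (rule Lim_null_comparison[OF always_eventually])
    show "\<forall>n. norm (prob (E1 n \<union> E2 n)) \<le> prob (E1 n) + prob (E2 n)"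
      using E by (simp add: measure_Un_le)
    show "(\<lambda>n. prob (E1 n) + prob (E2 n)) \<longlonglongrightarrow> 0" using tendsto_add[OF lims] by simp
  qed
  have "(\<lambda>n. real K * sqrt (B * (\<rho> / c) / real n)) \<longlonglongrightarrow> real K * sqrt 0"
    by (intro tendsto_mult tendsto_const tendsto_real_sqrt lim_const_over_n)
  then have "\<forall>\<^sub>F n in sequentially. real K * sqrt (B * (\<rho> / c) / real n) < \<delta>/4"
    by (rule order_tendstoD) (use \<delta> in simp)
  then have "\<forall>\<^sub>F n in sequentially. \<forall>\<omega>\<in>space M - (E1 n \<union> E2 n).
      \<bar>real_of_ereal (worst_case_risk f (\<rho> / real n) (empirical_measure N \<xi> n \<omega>) h) - (\<integral>s. h s \<partial>N)\<bar> \<le> \<delta>"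
    using eventually_gt_at_top[of 0]
  proof (eventually_elim, intro ballI)
    fix n :: nat and \<omega>
    assume Kn: "real K * sqrt (B * (\<rho> / c) / real n) < \<delta>/4" and n: "n > 0"
      and \<omega>: "\<omega> \<in> space M - (E1 n \<union> E2 n)"
    interpret empirical_sample N \<xi> n \<omega>
      by unfold_locales (use \<omega> n measurable_space[OF \<xi>] in auto)
    have w: "\<bar>real_of_ereal (worst_case_risk f (\<rho> / real n) Q h) - (\<Sum>i<n. h (\<xi> i \<omega>)) / real n\<bar>
        \<le> real K * sqrt (B * (\<rho> / c) / real n) + B * ((\<Sum>i<n. k (\<xi> i \<omega>)) / real n)"
      using worst_case_risk_deviation(2)[OF c f1 \<rho> hm, of "real K"] unfolding B_def k_def by simp
    have "\<bar>(\<Sum>i<n. k (\<xi> i \<omega>)) / real n - (\<integral>s. k s \<partial>N)\<bar> < \<delta>/(4*B)" using \<omega> by (auto simp: E2_def)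
    then have "(\<Sum>i<n. k (\<xi> i \<omega>)) / real n \<le> \<delta>/(4*B) + \<delta>/(4*B)"
      using K unfolding k_def[symmetric] by linarith
    then have "B * ((\<Sum>i<n. k (\<xi> i \<omega>)) / real n) \<le> B * (\<delta>/(4*B) + \<delta>/(4*B))"
      using B by (intro mult_left_mono) auto
    also have "\<dots> = \<delta>/2" using B by (simp add: field_simps)
    finally have "B * ((\<Sum>i<n. k (\<xi> i \<omega>)) / real n) \<le> \<delta>/2" .
    moreover have "\<bar>(\<Sum>i<n. h (\<xi> i \<omega>)) / real n - (\<integral>s. h s \<partial>N)\<bar> < \<delta>/4" using \<omega> by (auto simp: E1_def)
    ultimately show "\<bar>real_of_ereal (worst_case_risk f (\<rho> / real n) Q h) - (\<integral>s. h s \<partial>N)\<bar> \<le> \<delta>"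
      using w Kn by linarith
  qed
  then show ?thesis using E lim by (intro exI[of _ "\<lambda>n. E1 n \<union> E2 n"]) auto
qed

lemma vanishing_exceptional_events_finite_union:
  assumes "finite A"
    and "\<And>a. a \<in> A \<Longrightarrow> \<exists>E. (\<forall>n. E n \<in> events) \<and> (\<lambda>n. prob (E n)) \<longlonglongrightarrow> 0 \<and>
      (\<forall>\<^sub>F n in sequentially. \<forall>\<omega>\<in>space M - E n. R a n \<omega>)"
  shows "\<exists>E. (\<forall>n::nat. E n \<in> events) \<and> (\<lambda>n. prob (E n)) \<longlonglongrightarrow> 0 \<and>
      (\<forall>\<^sub>F n in sequentially. \<forall>\<omega>\<in>space M - E n. \<forall>a\<in>A. R a n \<omega>)"
proof -
  have "\<forall>a\<in>A. \<exists>E. (\<forall>n. E n \<in> events) \<and> (\<lambda>n. prob (E n)) \<longlonglongrightarrow> 0 \<and>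
      (\<forall>\<^sub>F n in sequentially. \<forall>\<omega>\<in>space M - E n. R a n \<omega>)"
    using assms(2) by blast
  from bchoice[OF this] obtain E where E: "\<And>a n. a \<in> A \<Longrightarrow> E a n \<in> events"
    "\<And>a. a \<in> A \<Longrightarrow> (\<lambda>n. prob (E a n)) \<longlonglongrightarrow> 0"
    "\<And>a. a \<in> A \<Longrightarrow> \<forall>\<^sub>F n in sequentially. \<forall>\<omega>\<in>space M - E a n. R a n \<omega>"
    by blast
  have "(\<lambda>n. prob (\<Union>a\<in>A. E a n)) \<longlonglongrightarrow> 0"
  proof (rule Lim_null_comparison[OF always_eventually])
    show "\<forall>n. norm (prob (\<Union>a\<in>A. E a n)) \<le> (\<Sum>a\<in>A. prob (E a n))"
      using finite_measure_subadditive_finite[OF assms(1)] E(1) by (simp add: image_subset_iff)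
    show "(\<lambda>n. \<Sum>a\<in>A. prob (E a n)) \<longlonglongrightarrow> 0" using E(2) by (intro tendsto_null_sum) auto
  qed
  moreover have "\<forall>\<^sub>F n in sequentially. \<forall>a\<in>A. \<forall>\<omega>\<in>space M - E a n. R a n \<omega>"
    using E(3) assms(1) by (intro eventually_ball_finite) auto
  then have "\<forall>\<^sub>F n in sequentially. \<forall>\<omega>\<in>space M - (\<Union>a\<in>A. E a n). \<forall>a\<in>A. R a n \<omega>"
    by eventually_elim auto
  ultimately show ?thesis
    using E(1) assms(1) by (intro exI[of _ "\<lambda>n. \<Union>a\<in>A. E a n"]) auto
qed

end

text \<open>Almost surely none of the countably many observations hits a given null set, which is
  then null for all empirical measures at once.\<close>

lemma (in prob_space) AE_empirical_measure:
  assumes \<xi>: "\<And>i. \<xi> i \<in> measurable M N" and distr: "\<And>i. distr M N (\<xi> i) = N"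
    and AE: "AE s in N. P s"
  shows "AE \<omega> in M. \<forall>n>0. AE s in empirical_measure N \<xi> n \<omega>. P s"
proof -
  obtain A where A: "A \<in> null_sets N" "{s\<in>space N. \<not> P s} \<subseteq> A"
    using AE by (auto elim: AE_E simp: null_sets_def)
  have "AE s in distr M N (\<xi> i). s \<notin> A" for i
    unfolding distr using A(1) by (rule AE_not_in)
  then have "AE \<omega> in M. \<xi> i \<omega> \<notin> A" for i
    by (rule AE_distrD[OF \<xi>])
  then have "AE \<omega> in M. \<forall>i. \<xi> i \<omega> \<notin> A"
    unfolding AE_all_countable by blast
  then show ?thesis
    using AE_space
  proof eventually_elim
    case (elim \<omega>)
    show ?case
    proof (intro allI impI)
      fix n :: nat assume "n > 0"
      then interpret empirical_sample N \<xi> n \<omega>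
        using elim measurable_space[OF \<xi>] by unfold_locales auto
      show "AE s in Q. P s" using A elim by (intro AE_Q[of A]) auto
    qed
  qed
qed

theorem theorem6:
  fixes P0 :: "'xi::{metric_space, second_countable_topology} measure"
    and M :: "'w measure"
    and X :: "(real ^ 'd) set"
    and l :: "real ^ 'd \<Rightarrow> 'xi \<Rightarrow> real"
    and g :: "real ^ 'd \<Rightarrow> 'xi \<Rightarrow> real"
    and f :: "real \<Rightarrow> ereal"
    and \<epsilon> \<rho> :: real
    and \<xi> :: "nat \<Rightarrow> 'w \<Rightarrow> 'xi"
  assumes P0: "prob_space P0"
    and X: "X \<noteq> {}" "closed X" "convex X"
    and l_measurable: "\<forall>x\<in>X. l x \<in> borel_measurable P0"
    and l_convex: "AE s in P0. proper_on X (\<lambda>x. ereal (l x s)) \<and>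
                     lsc_on X (\<lambda>x. ereal (l x s)) \<and> convex_on X (\<lambda>x. l x s)"
    and compact_or_coercive:
      "compact X \<or> filterlim (\<lambda>x. \<integral>s. l x s \<partial>P0) at_top (inf at_infinity (principal X))"
    and eps: "\<epsilon> > 0"
    and moment: "\<forall>x\<in>X. integrable P0 (\<lambda>s. \<bar>l x s\<bar> powr (1 + \<epsilon>))"
    and g_lower: "\<forall>x\<in>X. \<exists>U. open U \<and> x \<in> U \<and>
                    (\<forall>s\<in>space P0. ereal (g x s) \<le> (INF z\<in>U \<inter> X. ereal (l z s)))"
    and g_integrable: "\<forall>x\<in>X. integrable P0 (g x)"
    and f: "smooth_divergence_function f"
    and rho: "\<rho> > 0"
    and M: "prob_space M"
    and indep: "prob_space.indep_vars M (\<lambda>_. P0) \<xi> UNIV"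
    and ident: "\<forall>i. distr M P0 (\<xi> i) = P0"
    and empirical_moment:
      "\<forall>x\<in>X. AE \<omega> in M.
         (\<lambda>n. \<integral>s. \<bar>l x s\<bar> powr (1 + \<epsilon>) \<partial>empirical_measure P0 \<xi> n \<omega>)
           \<longlonglongrightarrow> (\<integral>s. \<bar>l x s\<bar> powr (1 + \<epsilon>) \<partial>P0)"
  shows "tendsto_outer_prob M
           (\<lambda>n \<omega>. INF x\<in>X. worst_case_risk f (\<rho> / real n) (empirical_measure P0 \<xi> n \<omega>) (l x))
           (INF x\<in>X. ereal (\<integral>s. l x s \<partial>P0))
       \<and> tendsto_outer_prob M
           (\<lambda>n \<omega>. enn2ereal (inclusion_distance
              (argmin_set X
                 (\<lambda>x. worst_case_risk f (\<rho> / real n) (empirical_measure P0 \<xi> n \<omega>) (l x)))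
              (argmin_set X (\<lambda>x. \<integral>s. l x s \<partial>P0))))
           0"
proof -
  interpret M: prob_space M by (rule M)
  interpret P0: prob_space P0 by (rule P0)
  have \<xi>: "\<xi> i \<in> measurable M P0" for i
    using indep unfolding M.indep_vars_def2 by simp
  define F where "F x = (\<integral>s. l x s \<partial>P0)" for x
  define W where "W n \<omega> x = worst_case_risk f (\<rho> / real n) (empirical_measure P0 \<xi> n \<omega>) (l x)" for n \<omega> x
  have l_int: "integrable P0 (l x)" if x: "x \<in> X" for x
  proof (rule Bochner_Integration.integrable_bound)
    show "integrable P0 (\<lambda>s. 1 + \<bar>l x s\<bar> powr (1 + \<epsilon>))" using moment x by simp
    have "\<bar>l x s\<bar> \<le> 1 + \<bar>l x s\<bar> powr (1 + \<epsilon>)" for s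
    proof (cases "\<bar>l x s\<bar> \<le> 1")
      case False
      then have "\<bar>l x s\<bar> powr 1 \<le> \<bar>l x s\<bar> powr (1 + \<epsilon>)" using eps by (intro powr_mono) auto
      then show ?thesis using False by simp
    qed (simp add: add_increasing2)
    then show "AE s in P0. norm (l x s) \<le> norm (1 + \<bar>l x s\<bar> powr (1 + \<epsilon>))" by simp
  qed (use l_measurable x in simp)
  have lsc: "AE s in P0. lsc_on X (\<lambda>x. ereal (l x s))" using l_convex by eventually_elim simp
  \<comment> \<open>This is lower semicontinuity of \<open>F\<close> on \<open>X\<close>, obtained
    from the local lower bounds \<open>g\<close> by Fatou's lemma.\<close>
  have closed: "closed {x\<in>X. F x \<le> a}" for a
    unfolding closed_sequential_limits
  proof (intro allI impI, elim conjE)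
    fix xs x assume xs: "\<forall>n. xs n \<in> {x\<in>X. F x \<le> a}" "xs \<longlonglongrightarrow> x"
    have x: "x \<in> X" using X(2) xs closed_sequentially[of X xs x] by auto
    obtain U where U: "open U" "x \<in> U" "\<forall>s\<in>space P0. ereal (g x s) \<le> (INF z\<in>U \<inter> X. ereal (l z s))"
      using g_lower x by blast
    have gl: "g x s \<le> l z s" if "z \<in> U" "z \<in> X" "s \<in> space P0" for z s
    proof -
      have "ereal (g x s) \<le> (INF z\<in>U \<inter> X. ereal (l z s))" using U(3) that by blast
      also have "\<dots> \<le> ereal (l z s)" using that by (intro INF_lower) auto
      finally show ?thesis by simp
    qed
    have xsX: "xs n \<in> X" and le: "(\<integral>s. l (xs n) s \<partial>P0) \<le> a" for n
      using xs(1) by (auto simp: F_def)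
    have gx: "integrable P0 (g x)" using g_integrable x by blast
    have "F x \<le> a"
      unfolding F_def by (rule integral_le_of_lsc_sequence[OF l_int lsc gx U(1,2) gl xsX xs(2) x le])
    then show "x \<in> {x\<in>X. F x \<le> a}" using x by simp
  qed
  have compact: "compact {x\<in>X. F x \<le> a}" for a
    using compact_sublevels_of_coercive[OF closed] compact_or_coercive unfolding F_def by blast
  obtain x0 where x0: "x0 \<in> X" "\<And>z. z \<in> X \<Longrightarrow> F x0 \<le> F z"
    using exists_minimizer_of_compact_sublevels[OF X(1) compact] by blast
  define v where "v = F x0"
  \<comment> \<open>As \<open>v\<close> is the minimal value, this sublevel set is the set of
    minimizers, and its compactness is already known.\<close>
  define S where "S = {x\<in>X. F x \<le> v}"
  have S: "S \<subseteq> X" "S \<noteq> {}" "bounded S" "\<And>x. x \<in> S \<Longrightarrow> F x = v"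
    using x0 compact[of v] by (auto simp: S_def v_def compact_imp_bounded intro: antisym)
  have argmin_S: "argmin_set X (\<lambda>x. \<integral>s. l x s \<partial>P0) = S"
    unfolding F_def[symmetric] argmin_set_def is_arg_min_def S_def v_def
    using x0 by (auto simp: not_less intro: order_trans)
  have INF_v: "(INF x\<in>X. ereal (\<integral>s. l x s \<partial>P0)) = ereal v"
    unfolding F_def[symmetric] v_def using x0 by (intro INF_eqI) auto
  \<comment> \<open>The same exceptional events serve the optimal value and the minimizers.\<close>
  have key: "\<exists>E. (\<forall>n. E n \<in> sets M) \<and> (\<lambda>n. measure M (E n)) \<longlonglongrightarrow> 0 \<and>
      (\<forall>\<^sub>F n in sequentially. \<forall>\<omega>\<in>space M - E n.
        \<bar>(INF x\<in>X. W n \<omega> x) - ereal v\<bar> \<le> ereal \<eta> \<and>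
        \<bar>enn2ereal (inclusion_distance (argmin_set X (W n \<omega>)) S) - 0\<bar> \<le> ereal \<eta>)"
    if \<eta>: "\<eta> > 0" for \<eta>
  proof -
    have v: "v \<le> F x" if "x \<in> X" for x using x0 that by (simp add: v_def)
    note sep = minimizers_well_separated[OF compact _ S_def S(2)]
    \<comment> \<open>\<open>A\<close> depends on \<open>\<eta>\<close> but not on \<open>n\<close>
      or the outcome, so pointwise consistency is needed only on a fixed finite set.\<close>
    obtain A \<delta> where A: "finite A" "A \<subseteq> X" "\<delta> > 0"
      and stable: "\<And>G. convex_on X G \<Longrightarrow> (\<And>a. a \<in> A \<Longrightarrow> \<bar>G a - F a\<bar> \<le> \<delta>) \<Longrightarrow>
       (\<forall>x\<in>X. v - \<eta> \<le> G x) \<and> (\<exists>x\<in>X. G x \<le> v + \<eta>) \<and>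
       (\<forall>x\<in>X. (\<forall>z\<in>X. G x \<le> G z) \<longrightarrow> infdist x S < \<eta>)"
      using convex_near_minimization_stability[OF X(2,3) S(1-3) v S(4) sep \<eta>] by metis
    have "\<exists>E. (\<forall>n::nat. E n \<in> sets M) \<and> (\<lambda>n. measure M (E n)) \<longlonglongrightarrow> 0 \<and>
      (\<forall>\<^sub>F n in sequentially. \<forall>\<omega>\<in>space M - E n. \<forall>a\<in>A. \<bar>real_of_ereal (W n \<omega> a) - F a\<bar> \<le> \<delta>)"
      unfolding W_def F_def using A rho l_int ident
      by (intro M.vanishing_exceptional_events_finite_union M.worst_case_risk_consistent indep f) auto
    then obtain E where E: "\<And>n. E n \<in> sets M" "(\<lambda>n. measure M (E n)) \<longlonglongrightarrow> 0"
      and near: "\<forall>\<^sub>F n in sequentially. \<forall>\<omega>\<in>space M - E n. \<forall>a\<in>A. \<bar>real_of_ereal (W n \<omega> a) - F a\<bar> \<le> \<delta>"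
      by blast
    have "AE s in P0. convex_on X (\<lambda>x. l x s)" using l_convex by eventually_elim simp
    from M.AE_empirical_measure[of \<xi>, OF \<xi> _ this] ident
    have "AE \<omega> in M. \<forall>n>0. AE s in empirical_measure P0 \<xi> n \<omega>. convex_on X (\<lambda>x. l x s)" by blast
    \<comment> \<open>Outside the null set \<open>Z\<close> all worst-case risks are convex; adding
      \<open>Z\<close> to the events leaves their probabilities unchanged.\<close>
    then obtain Z where Z: "Z \<in> null_sets M"
      "{\<omega>\<in>space M. \<not> (\<forall>n>0. AE s in empirical_measure P0 \<xi> n \<omega>. convex_on X (\<lambda>x. l x s))} \<subseteq> Z"
      by (auto elim: AE_E simp: null_sets_def)
    obtain c where c: "c > 0" "\<And>t. t \<ge> 0 \<Longrightarrow> ereal (c * min \<bar>t - 1\<bar> ((t - 1)\<^sup>2)) \<le> f t"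
      using smooth_divergence_function_lower_bound[OF f] by metis
    have f1: "f 1 = 0" using f by (simp add: smooth_divergence_function_def)
    have "\<forall>\<^sub>F n in sequentially. \<forall>\<omega>\<in>space M - (E n \<union> Z).
        \<bar>(INF x\<in>X. W n \<omega> x) - ereal v\<bar> \<le> ereal \<eta> \<and>
        \<bar>enn2ereal (inclusion_distance (argmin_set X (W n \<omega>)) S) - 0\<bar> \<le> ereal \<eta>"
      using near eventually_gt_at_top[of 0]
    proof (eventually_elim, intro ballI)
      fix n :: nat and \<omega>
      assume near: "\<forall>\<omega>\<in>space M - E n. \<forall>a\<in>A. \<bar>real_of_ereal (W n \<omega> a) - F a\<bar> \<le> \<delta>"
        and n: "n > 0" and \<omega>: "\<omega> \<in> space M - (E n \<union> Z)"
      interpret empirical_sample P0 \<xi> n \<omega>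
        using \<omega> n measurable_space[OF \<xi>] by unfold_locales auto
      define G where "G x = real_of_ereal (W n \<omega> x)" for x
      \<comment> \<open>Any truncation level shows finiteness; here it is 0.\<close>
      have fin: "\<bar>W n \<omega> x\<bar> \<noteq> \<infinity>" if "x \<in> X" for x
        unfolding W_def using worst_case_risk_deviation(1)[OF c f1, of \<rho> "l x" 0] rho l_measurable that by auto
      then have G: "W n \<omega> x = ereal (G x)" if "x \<in> X" for x
        using that by (simp add: G_def ereal_real')
      have conv: "AE s in Q. convex_on X (\<lambda>x. l x s)" using Z(2) \<omega> n by blast
      have "convex_on X G"
        unfolding G_def[abs_def] W_def
        by (rule convex_on_worst_case_risk[OF X(3) _ conv]) (use l_measurable fin in \<open>auto simp: W_def\<close>)
      then have st: "\<forall>x\<in>X. v - \<eta> \<le> G x" "\<exists>x\<in>X. G x \<le> v + \<eta>"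
        "\<And>x. x \<in> X \<Longrightarrow> \<forall>z\<in>X. G x \<le> G z \<Longrightarrow> infdist x S < \<eta>"
        using stable[of G] near \<omega> unfolding G_def by blast+
      have lower: "ereal (v - \<eta>) \<le> (INF x\<in>X. W n \<omega> x)"
        using st(1) G by (intro INF_greatest) simp
      obtain x1 where x1: "x1 \<in> X" "G x1 \<le> v + \<eta>" using st(2) by blast
      have "(INF x\<in>X. W n \<omega> x) \<le> W n \<omega> x1" using x1(1) by (rule INF_lower)
      then have upper: "(INF x\<in>X. W n \<omega> x) \<le> ereal (v + \<eta>)"
        using x1 G by (metis ereal_less_eq(3) order_trans)
      have inf_near: "\<bar>(INF x\<in>X. W n \<omega> x) - ereal v\<bar> \<le> ereal \<eta>"
        using lower upper by (cases "INF x\<in>X. W n \<omega> x") auto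
      \<comment> \<open>If the worst-case risk has no minimizer, the supremum over the empty set is
        0 and the bound holds trivially.\<close>
      have "inclusion_distance (argmin_set X (W n \<omega>)) S \<le> ennreal \<eta>"
        unfolding inclusion_distance_def
      proof (rule SUP_least)
        fix x assume "x \<in> argmin_set X (W n \<omega>)"
        then have x: "x \<in> X" "\<forall>z\<in>X. G x \<le> G z"
          using G by (auto simp: argmin_set_def is_arg_min_def not_less)
        from st(3)[OF this] obtain y where y: "y \<in> S" "dist x y < \<eta>"
          unfolding infdist_notempty[OF S(2)] using S(2) by (auto simp: cINF_less_iff)
        have "(INF y\<in>S. ennreal (dist x y)) \<le> ennreal (dist x y)" using y(1) by (rule INF_lower)
        also have "\<dots> \<le> ennreal \<eta>" using y(2) by (intro ennreal_leI) simp
        finally show "(INF y\<in>S. ennreal (dist x y)) \<le> ennreal \<eta>" .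
      qed
      then have "enn2ereal (inclusion_distance (argmin_set X (W n \<omega>)) S) \<le> ereal \<eta>"
        using \<eta> by (simp add: less_eq_ennreal.rep_eq enn2ereal_ennreal)
      then show "\<bar>(INF x\<in>X. W n \<omega> x) - ereal v\<bar> \<le> ereal \<eta> \<and>
        \<bar>enn2ereal (inclusion_distance (argmin_set X (W n \<omega>)) S) - 0\<bar> \<le> ereal \<eta>"
        using inf_near by simp
    qed
    moreover have "measure M (E n \<union> Z) = measure M (E n)" for n
      using E(1) Z(1) by (rule measure_Un_null_set)
    ultimately show ?thesis
      using E Z(1) by (intro exI[of _ "\<lambda>n. E n \<union> Z"]) auto
  qed
  show ?thesis
    unfolding argmin_S INF_v W_def[symmetric]
  proof (intro conjI tendsto_outer_probI M.finite_measure_axioms)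
    fix \<eta> :: real assume "\<eta> > 0"
    from key[OF this] obtain E where E: "\<forall>n. E n \<in> sets M" "(\<lambda>n. measure M (E n)) \<longlonglongrightarrow> 0"
      and ev: "\<forall>\<^sub>F n in sequentially. \<forall>\<omega>\<in>space M - E n.
        \<bar>(INF x\<in>X. W n \<omega> x) - ereal v\<bar> \<le> ereal \<eta> \<and>
        \<bar>enn2ereal (inclusion_distance (argmin_set X (W n \<omega>)) S) - 0\<bar> \<le> ereal \<eta>" by blast
    show "\<exists>E. (\<forall>n. E n \<in> sets M) \<and> (\<lambda>n. measure M (E n)) \<longlonglongrightarrow> 0 \<and>
      (\<forall>\<^sub>F n in sequentially. \<forall>\<omega>\<in>space M - E n. \<bar>(INF x\<in>X. W n \<omega> x) - ereal v\<bar> \<le> ereal \<eta>)"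
      using E ev by (intro exI[of _ E] conjI) (auto elim: eventually_mono)
    show "\<exists>E. (\<forall>n. E n \<in> sets M) \<and> (\<lambda>n. measure M (E n)) \<longlonglongrightarrow> 0 \<and>
      (\<forall>\<^sub>F n in sequentially. \<forall>\<omega>\<in>space M - E n.
        \<bar>enn2ereal (inclusion_distance (argmin_set X (\<lambda>x. W n \<omega> x)) S) - 0\<bar> \<le> ereal \<eta>)"
      using E ev by (intro exI[of _ E] conjI) (auto elim: eventually_mono)
  qed
qed

end
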